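(* Let $\{A_i\}_{i\in I}$ be a finite family of invertible positive $2\times 2$ matrices, and let $\mu$ be the Bernoulli measure on $I^{\mathbb N}$ associated to a probability vector $(w_i)_{i\in I}$ with all $w_i>0$. Let $f_i=[F(A_i)]$ for $i\in I$, put $$\boldsymbol v=\sum_{i\in I} w_i\; v\!\left(f_i(0)\,;\,\tfrac12\log\!\left(\frac{\det F(A_i)}{f_i'(0)}\right)\right)\in V,$$ and let $T=(b_{k,n})_{k,n\in\mathbb N_0}$ be the infinite matrix with $$b_{k,0}=0\quad (k\ge 0),\qquad b_{0,n}=\sum_{i\in I}w_i\,\big(f_i^{\top}(0)\big)^n\quad (n\ge 1),$$ $$b_{k,n}=\sum_{i\in I}w_i\sum_{\ell=1}^{\min\{k,n\}}\binom{n}{\ell}\binom{k-1}{\ell-1}\big(f_i^{\top}(0)\big)^{n-\ell}\big(-f_i(0)\big)^{k-\ell}\big(f_i'(0)\big)^{\ell}\quad (k,n\ge 1).$$ Then $T$ defines a linear operator $T:V\to V$, and the top Lyapunov exponent $\lambda$ of $\{A_i\}_{i\in I}$ with weights $(w_i)_{i\in I}$ satisfies $$\lambda=\sum_{n=0}^{\infty}\big(T^n\boldsymbol v\big)_0,$$ where the series converges and $(\cdot)_0$ denotes the $0$-th coordinate.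
   Context: $\mathbb N=\{1,2,\dots\}$, $\mathbb N_0=\mathbb N\cup\{0\}$. A matrix is positive if all its entries are $>0$. Powers use the convention $0^0=1$. Lyapunov exponent: for $\mu$-a.e. sequence $(i_n)_{n\in\mathbb N}\in I^{\mathbb N}$ the limit $\lambda=\lim_{n\to\infty}\frac1n\log\|A_{i_n}\cdots A_{i_1}\|$ exists and is a constant independent of the sequence and of the norm (Furstenberg--Kesten); this constant is the top Lyapunov exponent. Möbius maps: $\widehat{\mathbb C}=\mathbb C\cup\{\widehat\infty\}$ is the Riemann sphere, and $\mathrm{PGL}_2(\mathbb R)=\mathrm{GL}_2(\mathbb R)/\sim$, where $A\sim B$ iff $A=tB$ for some $t\in\mathbb R\setminus\{0\}$. The class $[M]$ of $M=\begin{pmatrix}\alpha&\beta\\ \gamma&\delta\end{pmatrix}$ is identified with the Möbius transformation $f(x)=\frac{\alpha x+\beta}{\gamma x+\delta}$ of $\widehat{\mathbb C}$. For $f=[M]$ put $f^{\top}=[M^{\top}]$. The map $F:\mathrm{GL}_2(\mathbb R)\to\mathrm{GL}_2(\mathbb R)$ is $$F\begin{pmatrix}p&q\\ r&s\end{pmatrix}=\frac12\begin{pmatrix}p-q-r+s&p+q-r-s\\ p-q+r-s&p+q+r+s\end{pmatrix}.$$ For a positive invertible matrix $A$ one has $\det F(A)/f_A'(0)>0$, where $f_A=[F(A)]$. Sequence space: $\ell^\infty(\mathbb N_0)$ is the space of bounded complex sequences indexed by $\mathbb N_0$. For $x,c\in\mathbb C$ with $|x|\le1$, $v(x;c)\in\ell^\infty(\mathbb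 N_0)$ is given by $(v(x;c))_0=c$ and $(v(x;c))_n=-\frac{(-x)^n}{n}$ for $n\ge1$. $V$ is the algebraic linear span over $\mathbb C$ of all $v(x;c)$ with $x,c\in\mathbb C$, $|x|\le1$. For an infinite matrix $T=(b_{k,n})_{k,n\in\mathbb N_0}$ and $u\in\ell^\infty(\mathbb N_0)$, $(Tu)_k=\sum_{n=0}^\infty b_{k,n}u_n$ whenever these series converge for all $k\in\mathbb N_0$. *)

theory Defs
  imports "HOL-Probability.Probability" "HOL-Library.Function_Algebras"
begin

definition positive_matrix :: "real^'n^'m \<Rightarrow> bool" where
  "positive_matrix A \<longleftrightarrow> (\<forall>i j. A $ i $ j > 0)"


definition bernoulli_measure :: "'i set \<Rightarrow> ('i \<Rightarrow> real) \<Rightarrow> (nat \<Rightarrow> 'i) measure" where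
  "bernoulli_measure I w = (\<Pi>\<^sub>M n\<in>{1..}. point_measure I (\<lambda>i. ennreal (w i)))"

text \<open>The product \<open>A (\<omega> n) ** \<dots> ** A (\<omega> 1)\<close>; each new factor is multiplied on the left.\<close>
primrec matrix_cocycle :: "('i \<Rightarrow> real^'n^'n) \<Rightarrow> (nat \<Rightarrow> 'i) \<Rightarrow> nat \<Rightarrow> real^'n^'n" where
  "matrix_cocycle A \<omega> 0 = mat 1"
| "matrix_cocycle A \<omega> (Suc n) = A (\<omega> (Suc n)) ** matrix_cocycle A \<omega> n"

text \<open>Existence of the limit is the Furstenberg--Kesten theorem; the value does not depend on
  the matrix norm, and \<open>norm\<close> here is the Frobenius norm.\<close>
definition top_lyapunov_exponent ::
    "'i set \<Rightarrow> ('i \<Rightarrow> real) \<Rightarrow> ('i \<Rightarrow> real^'n^'n) \<Rightarrow> real" where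
  "top_lyapunov_exponent I w A = (THE L. AE \<omega> in bernoulli_measure I w.
     (\<lambda>n. 1 / real n * ln (norm (matrix_cocycle A \<omega> n))) \<longlonglongrightarrow> L)"


definition F_map :: "real^2^2 \<Rightarrow> real^2^2" where
  "F_map A = (let p = A $ 1 $ 1; q = A $ 1 $ 2; r = A $ 2 $ 1; s = A $ 2 $ 2 in
     (1 / 2) *\<^sub>R vector [vector [p - q - r + s, p + q - r - s],
                     vector [p - q + r - s, p + q + r + s]])"

text \<open>The Moebius transformation \<open>[M]\<close> read in the affine chart: where the denominator
  vanishes, the value on the Riemann sphere is \<open>\<infinity>\<close> and the value below is meaningless. The map
  depends only on the class of \<open>M\<close> in PGL(2), and \<open>[M]\<^sup>\<top>\<close> is \<open>moebius (transpose M)\<close>.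
  For \<open>M = F_map A\<close> with \<open>A\<close> positive, the point \<open>0\<close> is not a pole of either map.\<close>
definition moebius :: "real^2^2 \<Rightarrow> complex \<Rightarrow> complex" where
  "moebius M x = (of_real (M $ 1 $ 1) * x + of_real (M $ 1 $ 2)) /
                 (of_real (M $ 2 $ 1) * x + of_real (M $ 2 $ 2))"


definition seq_scale :: "complex \<Rightarrow> (nat \<Rightarrow> complex) \<Rightarrow> nat \<Rightarrow> complex" where
  "seq_scale a u = (\<lambda>n. a * u n)"

interpretation cseq: vector_space seq_scale
  by unfold_locales (auto simp: seq_scale_def fun_eq_iff algebra_simps)

definition vseq :: "complex \<Rightarrow> complex \<Rightarrow> nat \<Rightarrow> complex" where
  "vseq x c = (\<lambda>n. if n = 0 then c else - ((- x) ^ n / of_nat n))"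

text \<open>Each \<open>vseq x c\<close> with \<open>cmod x \<le> 1\<close> is bounded, so the span taken inside all complex
  sequences coincides with the span taken inside the bounded ones.\<close>
definition V_space :: "(nat \<Rightarrow> complex) set" where
  "V_space = cseq.span {vseq x c | x c. cmod x \<le> 1}"

definition infmat_apply ::
    "(nat \<Rightarrow> nat \<Rightarrow> complex) \<Rightarrow> (nat \<Rightarrow> complex) \<Rightarrow> nat \<Rightarrow> complex" where
  "infmat_apply B u = (\<lambda>k. \<Sum>n. B k n * u n)"

definition defines_linear_operator_on ::
    "(nat \<Rightarrow> nat \<Rightarrow> complex) \<Rightarrow> (nat \<Rightarrow> complex) set \<Rightarrow> bool" where
  "defines_linear_operator_on B S \<longleftrightarrow>
     (\<forall>u\<in>S. \<forall>k. summable (\<lambda>n. B k n * u n)) \<and>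
     (\<forall>u\<in>S. infmat_apply B u \<in> S) \<and>
     (\<forall>u\<in>S. \<forall>u'\<in>S. infmat_apply B (u + u') = infmat_apply B u + infmat_apply B u') \<and>
     (\<forall>a. \<forall>u\<in>S. infmat_apply B (seq_scale a u) = seq_scale a (infmat_apply B u))"


definition lyap_vector ::
    "'i set \<Rightarrow> ('i \<Rightarrow> real) \<Rightarrow> ('i \<Rightarrow> real^2^2) \<Rightarrow> nat \<Rightarrow> complex" where
  "lyap_vector I w A = (\<Sum>i\<in>I. let f = moebius (F_map (A i)) in
     seq_scale (of_real (w i))
       (vseq (f 0) (1 / 2 * ln (of_real (det (F_map (A i))) / deriv f 0))))"

definition lyap_matrix ::
    "'i set \<Rightarrow> ('i \<Rightarrow> real) \<Rightarrow> ('i \<Rightarrow> real^2^2) \<Rightarrow> nat \<Rightarrow> nat \<Rightarrow> complex" where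
  "lyap_matrix I w A k n =
     (if n = 0 then 0
      else if k = 0 then \<Sum>i\<in>I. of_real (w i) * moebius (transpose (F_map (A i))) 0 ^ n
      else \<Sum>i\<in>I. let f = moebius (F_map (A i)); ft = moebius (transpose (F_map (A i))) in
        of_real (w i) *
        (\<Sum>l = 1..min k n. of_nat (n choose l) * of_nat ((k - 1) choose (l - 1)) *
           ft 0 ^ (n - l) * (- f 0) ^ (k - l) * deriv f 0 ^ l))"

end

(* The change of coordinates F turns the action of a positive matrix on directions into a
   Moebius map of the closed unit disc. Reading vseq x c as the Taylor coefficients of
   y -> c + log (1 + x y), the matrix T sends a function phi to
   sum_i w_i phi o f_i^T - phi(0), which on the spanning vectors is an explicit finite
   combination of vseq (f_i x) and vseq (f_i 0).

   Let e_n be the mean of vseq (disc coordinate of u, log of half the entry sum of u) over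
   u = A_{i_n} ... A_{i_1} (1,1), and a_n its entry 0. Then T e_n = e_{n+1} - e_1 - a_n delta_0,
   hence T^n v = e_{n+1} - e_n - (a_n - a_{n-1}) delta_0, and the partial sums of the series
   telescope to a_{N+1} - a_N.

   Positive matrices contract log (u_1/u_2), so a_{N+1} - a_N converges exponentially fast and
   the Poisson equation for the logarithmic growth has a solution. This makes
   log |A_{i_n} ... A_{i_1}| - n lim (a_{N+1} - a_N) a martingale with bounded increments up to a
   bounded error, and a fourth-moment estimate identifies the limit with the Lyapunov exponent. *)
theory Submission
  imports Defs
begin

section \<open>Contraction by positive matrices\<close>

text \<open>The derivative is \<open>(a * d - b * c) * exp t\<close> over a product whose expansion
  contains \<open>(a * d + b * c) * exp t\<close>; dropping the other two positive terms bounds it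
  uniformly in \<open>t\<close>. In the variable \<open>t = ln (u1 / u2)\<close> this controls both
  the projective action and the growth of a linear form.\<close>

lemma ln_affine_exp_lipschitz:
  fixes a b c d y z :: real
  assumes "a > 0" "b > 0" "c > 0" "d > 0"
  defines "g \<equiv> \<lambda>t. ln (a * exp t + b) - ln (c * exp t + d)"
  shows "\<bar>g y - g z\<bar> \<le> \<bar>a * d - b * c\<bar> / (a * d + b * c) * \<bar>y - z\<bar>"
proof -
  define g' where "g' t = a * exp t / (a * exp t + b) - c * exp t / (c * exp t + d)" for t
  have pos: "a * exp t + b > 0" "c * exp t + d > 0" for t
    using assms(1-4) by (auto intro: add_pos_pos)
  have deriv: "(g has_real_derivative g' t) (at t)" for t
    unfolding g_def g'_def
    by (rule derivative_eq_intros refl | use pos in \<open>force simp: divide_inverse\<close>)+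
  have bound: "\<bar>g' t\<bar> \<le> \<bar>a * d - b * c\<bar> / (a * d + b * c)" for t
  proof -
    have eq: "g' t = (a * d - b * c) * exp t / ((a * exp t + b) * (c * exp t + d))"
      using pos[of t] by (simp add: g'_def field_simps)
    have "(a * d + b * c) * exp t \<le> (a * exp t + b) * (c * exp t + d)"
      using assms(1-4) by (simp add: algebra_simps)
    hence "exp t / ((a * exp t + b) * (c * exp t + d)) \<le> 1 / (a * d + b * c)"
      using pos[of t] assms(1-4) by (simp add: divide_simps add_pos_pos mult.commute)
    hence "\<bar>a * d - b * c\<bar> * (exp t / ((a * exp t + b) * (c * exp t + d)))
        \<le> \<bar>a * d - b * c\<bar> * (1 / (a * d + b * c))"
      by (rule mult_left_mono) simp
    thus ?thesis
      using pos[of t] by (simp add: eq abs_mult)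
  qed
  have "norm (g y - g z) \<le> \<bar>a * d - b * c\<bar> / (a * d + b * c) * norm (y - z)"
    by (rule field_differentiable_bound[of UNIV g g'])
       (use deriv bound in auto)
  thus ?thesis by simp
qed

section \<open>Size and direction of a positive vector\<close>

definition half_sum :: "real^2 \<Rightarrow> real" where
  "half_sum u = (u $ 1 + u $ 2) / 2"

text \<open>The Cayley transform of the slope: positive directions fill the interval (-1, 1), and
  the diagonal goes to 0.\<close>

definition disc_coord :: "real^2 \<Rightarrow> real" where
  "disc_coord u = (u $ 1 - u $ 2) / (u $ 1 + u $ 2)"

text \<open>Differences of this coordinate, in absolute value, are the Hilbert projective distance
  on the positive quadrant.\<close>

definition log_slope :: "real^2 \<Rightarrow> real" where
  "log_slope u = ln (u $ 1) - ln (u $ 2)"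

definition pos_vec :: "real^2 \<Rightarrow> bool" where
  "pos_vec u \<longleftrightarrow> u $ 1 > 0 \<and> u $ 2 > 0"

lemma ln_affine_log_slope:
  assumes "pos_vec u" "a > 0" "b > 0"
  shows "ln (a * u $ 1 + b * u $ 2) = ln (u $ 2) + ln (a * exp (log_slope u) + b)"
proof -
  have u: "u $ 1 > 0" "u $ 2 > 0" using assms by (auto simp: pos_vec_def)
  have "exp (log_slope u) = u $ 1 / u $ 2"
    using u by (simp add: log_slope_def exp_diff)
  hence "a * u $ 1 + b * u $ 2 = u $ 2 * (a * exp (log_slope u) + b)"
    using u by (simp add: field_simps)
  moreover have "a * exp (log_slope u) + b > 0"
    using assms by (auto intro: add_pos_pos)
  ultimately show ?thesis using u by (simp add: ln_mult)
qed

lemma matrix_vector_mult_2: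
  fixes B :: "real^2^2"
  shows "(B *v u) $ 1 = B $ 1 $ 1 * u $ 1 + B $ 1 $ 2 * u $ 2"
    and "(B *v u) $ 2 = B $ 2 $ 1 * u $ 1 + B $ 2 $ 2 * u $ 2"
  by (simp_all add: matrix_vector_mult_def sum_2)

text \<open>The constant delivered by \<open>ln_affine_exp_lipschitz\<close>; it is cruder than
  Birkhoff's coefficient but still below 1 for positive matrices.\<close>

definition contraction_ratio :: "real^2^2 \<Rightarrow> real" where
  "contraction_ratio B = \<bar>det B\<bar> / (B $ 1 $ 1 * B $ 2 $ 2 + B $ 1 $ 2 * B $ 2 $ 1)"

lemma pos_vec_matrix_mult:
  assumes "positive_matrix B" "pos_vec u"
  shows "pos_vec (B *v u)"
  using assms by (auto simp: pos_vec_def positive_matrix_def matrix_vector_mult_2 intro!: add_pos_pos)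

lemma contraction_ratio_bounds:
  assumes "positive_matrix B"
  shows "0 \<le> contraction_ratio B" "contraction_ratio B < 1"
proof -
  have p: "B $ 1 $ 1 * B $ 2 $ 2 > 0" "B $ 1 $ 2 * B $ 2 $ 1 > 0"
    using assms by (auto simp: positive_matrix_def)
  thus "0 \<le> contraction_ratio B" "contraction_ratio B < 1"
    by (auto simp: contraction_ratio_def det_2 divide_less_eq)
qed

lemma log_slope_contraction:
  assumes B: "positive_matrix B" and u: "pos_vec u" "pos_vec v"
  shows "\<bar>log_slope (B *v u) - log_slope (B *v v)\<bar> \<le> contraction_ratio B * \<bar>log_slope u - log_slope v\<bar>"
proof -
  have p: "B $ 1 $ 1 > 0" "B $ 1 $ 2 > 0" "B $ 2 $ 1 > 0" "B $ 2 $ 2 > 0"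
    using B by (auto simp: positive_matrix_def)
  show ?thesis
    using ln_affine_exp_lipschitz[OF p, of "log_slope u" "log_slope v"] u p
    by (simp add: log_slope_def[of "_ *v _"] matrix_vector_mult_2 ln_affine_log_slope
        contraction_ratio_def det_2)
qed

lemma half_sum_pos: "pos_vec u \<Longrightarrow> half_sum u > 0"
  by (simp add: pos_vec_def half_sum_def)

text \<open>The logarithmic growth depends only on the direction: with column sums \<open>a\<close>
  and \<open>b\<close> it is \<open>ln (a * exp s + b) - ln (exp s + 1)\<close> at
  \<open>s = log_slope u\<close>. The Lipschitz constant \<open>\<bar>a - b\<bar> / (a + b)\<close>
  is at most 1.\<close>

lemma ln_half_sum_growth_lipschitz:
  assumes B: "positive_matrix B" and u: "pos_vec u" "pos_vec v"
  shows "\<bar>(ln (half_sum (B *v u)) - ln (half_sum u)) - (ln (half_sum (B *v v)) - ln (half_sum v))\<bar>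
      \<le> \<bar>log_slope u - log_slope v\<bar>"
proof -
  define a where "a = B $ 1 $ 1 + B $ 2 $ 1"
  define b where "b = B $ 1 $ 2 + B $ 2 $ 2"
  have p: "a > 0" "b > 0" "0 < (1::real)"
    using B by (auto simp: positive_matrix_def a_def b_def intro!: add_pos_pos)
  have growth: "ln (half_sum (B *v u)) - ln (half_sum u)
      = ln (a * exp (log_slope u) + b) - ln (1 * exp (log_slope u) + 1)" if u: "pos_vec u" for u
  proof -
    have eq: "half_sum (B *v u) = (a * u $ 1 + b * u $ 2) / 2" "half_sum u = (1 * u $ 1 + 1 * u $ 2) / 2"
      by (simp_all add: half_sum_def matrix_vector_mult_2 a_def b_def algebra_simps)
    have "a * u $ 1 + b * u $ 2 > 0" "1 * u $ 1 + 1 * u $ 2 > 0"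
      using u p by (auto simp: pos_vec_def intro!: add_pos_pos)
    thus ?thesis
      using ln_affine_log_slope[OF u p(1,2)] ln_affine_log_slope[OF u p(3,3)]
      unfolding eq by (simp add: ln_div)
  qed
  have "\<bar>a * 1 - b * 1\<bar> / (a * 1 + b * 1) * \<bar>log_slope u - log_slope v\<bar> \<le> 1 * \<bar>log_slope u - log_slope v\<bar>"
    using p by (intro mult_right_mono) (auto simp: divide_le_eq)
  thus ?thesis
    using ln_affine_exp_lipschitz[OF p(1,2,3,3), of "log_slope u" "log_slope v"]
    unfolding growth[OF u(1)] growth[OF u(2)] by simp
qed

section \<open>Averaging over one random step\<close>

lemma geometric_increments_limit:
  fixes x :: "nat \<Rightarrow> real"
  assumes step: "\<And>n. \<bar>x (Suc n) - x n\<bar> \<le> c * r ^ n" and r: "0 \<le> r" "r < 1"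
  shows "\<exists>L. x \<longlonglongrightarrow> L \<and> (\<forall>n. \<bar>x n - L\<bar> \<le> c / (1 - r) * r ^ n)"
proof -
  have geo: "(\<lambda>k. c * r ^ (k + n)) sums (c / (1 - r) * r ^ n)" for n
    using sums_mult[OF geometric_sums[of r], of "c * r ^ n"] r by (simp add: power_add mult_ac)
  have le: "norm (x (Suc (k + n)) - x (k + n)) \<le> c * r ^ (k + n)" for k n
    using step by simp
  have summ: "summable (\<lambda>k. x (Suc (k + n)) - x (k + n))" for n
    using le by (intro summable_comparison_test[OF _ sums_summable[OF geo]]) auto
  have "(\<lambda>m. \<Sum>k<m. x (Suc k) - x k) \<longlonglongrightarrow> (\<Sum>k. x (Suc k) - x k)"
    using summable_LIMSEQ[OF summ[of 0]] by simp
  hence "(\<lambda>m. (x m - x 0) + x 0) \<longlonglongrightarrow> (\<Sum>k. x (Suc k) - x k) + x 0"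
    unfolding sum_lessThan_telescope by (intro tendsto_add tendsto_const)
  then obtain L where L: "x \<longlonglongrightarrow> L" by auto
  have "\<bar>x n - L\<bar> \<le> c / (1 - r) * r ^ n" for n
  proof -
    have "(\<lambda>k. x (Suc (k + n)) - x (k + n)) sums (L - x (0 + n))"
      using telescope_sums[OF LIMSEQ_ignore_initial_segment[OF L, of n]] by simp
    thus ?thesis
      using norm_suminf_le[OF le sums_summable[OF geo], of n] sums_unique[OF geo, of n]
      by (simp add: sums_iff abs_minus_commute)
  qed
  thus ?thesis using L by blast
qed

locale positive_matrix_family =
  fixes I :: "'i set" and A :: "'i \<Rightarrow> real^2^2" and w :: "'i \<Rightarrow> real"
  assumes finite_I: "finite I"
    and positive_A: "i \<in> I \<Longrightarrow> positive_matrix (A i)"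
    and weight_pos: "i \<in> I \<Longrightarrow> w i > 0"
    and weight_sum: "(\<Sum>i\<in>I. w i) = 1"
begin

text \<open>The Markov operator of the random walk \<open>u \<mapsto> A i *v u\<close>; its n-th
  power is the expectation after n steps. The codomain is general because both real logarithms and
  complex sequence entries get averaged.\<close>

definition avg :: "(real^2 \<Rightarrow> 'b::real_vector) \<Rightarrow> real^2 \<Rightarrow> 'b" where
  "avg \<Phi> u = (\<Sum>i\<in>I. w i *\<^sub>R \<Phi> (A i *v u))"

lemma I_nonempty: "I \<noteq> {}"
  using weight_sum by auto

lemma avg_const: "avg (\<lambda>_. c) u = c"
  by (simp add: avg_def scaleR_sum_left[symmetric] weight_sum)

lemma avg_add: "avg (\<lambda>u. \<Phi> u + \<Psi> u) u = avg \<Phi> u + avg \<Psi> u"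
  by (simp add: avg_def scaleR_add_right sum.distrib)

lemma avg_diff: "avg (\<lambda>u. \<Phi> u - \<Psi> u) u = avg \<Phi> u - avg \<Psi> u"
  by (simp add: avg_def scaleR_diff_right sum_subtractf)

lemma avg_cmult: "avg (\<lambda>u. c * \<Phi> u :: real) u = c * avg \<Phi> u"
  by (simp add: avg_def sum_distrib_left algebra_simps)

lemma funpow_avg_const: "(avg ^^ n) (\<lambda>_. c) = (\<lambda>_. c)"
  by (induction n) (auto simp: avg_const intro!: ext)

lemma funpow_avg_add: "(avg ^^ n) (\<lambda>u. \<Phi> u + \<Psi> u) = (\<lambda>u. (avg ^^ n) \<Phi> u + (avg ^^ n) \<Psi> u)"
  by (induction n) (auto simp: avg_add intro!: ext)

lemma funpow_avg_diff: "(avg ^^ n) (\<lambda>u. \<Phi> u - \<Psi> u) = (\<lambda>u. (avg ^^ n) \<Phi> u - (avg ^^ n) \<Psi> u)"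
  by (induction n) (auto simp: avg_diff intro!: ext)

lemma funpow_avg_cmult: "(avg ^^ n) (\<lambda>u. c * \<Phi> u :: real) = (\<lambda>u. c * (avg ^^ n) \<Phi> u)"
  by (induction n) (auto simp: avg_cmult intro!: ext)

lemma avg_mono:
  assumes "\<And>i. i \<in> I \<Longrightarrow> \<Phi> (A i *v u) \<le> (\<Psi> (A i *v u) :: real)"
  shows "avg \<Phi> u \<le> avg \<Psi> u"
  unfolding avg_def using assms weight_pos
  by (intro sum_mono) (auto intro!: mult_left_mono simp: less_imp_le)

text \<open>Coupling: the same letter drives the walks from \<open>u\<close> and from
  \<open>v\<close>, so a bound for each letter survives averaging.\<close>

lemma abs_avg_diff_le:
  fixes \<Phi> \<Psi> :: "real^2 \<Rightarrow> real"
  assumes "\<And>i. i \<in> I \<Longrightarrow> \<bar>\<Phi> (A i *v u) - \<Psi> (A i *v v)\<bar> \<le> c"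
  shows "\<bar>avg \<Phi> u - avg \<Psi> v\<bar> \<le> c"
proof -
  have "\<bar>avg \<Phi> u - avg \<Psi> v\<bar> = \<bar>\<Sum>i\<in>I. w i * (\<Phi> (A i *v u) - \<Psi> (A i *v v))\<bar>"
    by (simp add: avg_def sum_subtractf[symmetric] algebra_simps)
  also have "\<dots> \<le> (\<Sum>i\<in>I. w i * c)"
    using assms weight_pos
    by (intro order.trans[OF sum_abs] sum_mono)
       (auto simp: abs_mult less_imp_le intro!: mult_left_mono)
  also have "\<dots> = c"
    by (simp add: sum_distrib_right[symmetric] weight_sum)
  finally show ?thesis .
qed

definition ratio :: real where
  "ratio = Max ((\<lambda>i. contraction_ratio (A i)) ` I)"

lemma ratio_bounds: "0 \<le> ratio" "ratio < 1"
proof -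
  have "ratio \<in> (\<lambda>i. contraction_ratio (A i)) ` I"
    unfolding ratio_def using finite_I I_nonempty by (intro Max_in) auto
  thus "0 \<le> ratio" "ratio < 1"
    using contraction_ratio_bounds positive_A by auto
qed

lemma log_slope_contraction_family:
  assumes "i \<in> I" "pos_vec u" "pos_vec v"
  shows "\<bar>log_slope (A i *v u) - log_slope (A i *v v)\<bar> \<le> ratio * \<bar>log_slope u - log_slope v\<bar>"
proof -
  have "contraction_ratio (A i) \<le> ratio"
    unfolding ratio_def using finite_I assms by (intro Max_ge) auto
  thus ?thesis
    using log_slope_contraction[OF positive_A[OF assms(1)] assms(2,3)]
    by (smt (verit) mult_right_mono)
qed

section \<open>An invariant cone with uniformly bounded slopes\<close>

definition slope_bound :: real where
  "slope_bound = (\<Sum>i\<in>I. \<bar>log_slope (A i *v 1)\<bar>) / (1 - ratio)"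

definition slope_cone :: "(real^2) set" where
  "slope_cone = {u. pos_vec u \<and> \<bar>log_slope u\<bar> \<le> slope_bound}"

lemma pos_vec_one: "pos_vec 1"
  by (simp add: pos_vec_def)

lemma log_slope_one: "log_slope 1 = 0"
  by (simp add: log_slope_def)

lemma slope_bound_nonneg: "0 \<le> slope_bound"
  using ratio_bounds by (simp add: slope_bound_def sum_nonneg)

lemma one_in_cone: "1 \<in> slope_cone"
  using slope_bound_nonneg by (simp add: slope_cone_def pos_vec_one log_slope_one)

lemma cone_pos: "u \<in> slope_cone \<Longrightarrow> pos_vec u"
  by (simp add: slope_cone_def)

text \<open>\<open>slope_bound\<close> is chosen so that the displacement of the centre
  \<open>1\<close>, at most \<open>(1 - ratio) * slope_bound\<close>, and the contracted slope, at
  most \<open>ratio * slope_bound\<close>, add up to no more than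
  \<open>slope_bound\<close>.\<close>

lemma cone_invariant:
  assumes "i \<in> I" "u \<in> slope_cone"
  shows "A i *v u \<in> slope_cone"
proof -
  have "\<bar>log_slope (A i *v 1)\<bar> \<le> (\<Sum>i\<in>I. \<bar>log_slope (A i *v 1)\<bar>)"
    using finite_I assms by (intro member_le_sum) auto
  hence "\<bar>log_slope (A i *v 1)\<bar> \<le> (1 - ratio) * slope_bound"
    using ratio_bounds by (simp add: slope_bound_def)
  moreover have "\<bar>log_slope (A i *v u) - log_slope (A i *v 1)\<bar> \<le> ratio * \<bar>log_slope u\<bar>"
    using log_slope_contraction_family[OF assms(1) cone_pos[OF assms(2)] pos_vec_one]
    by (simp add: log_slope_one)
  moreover have "ratio * \<bar>log_slope u\<bar> \<le> ratio * slope_bound"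
    using assms ratio_bounds by (intro mult_left_mono) (auto simp: slope_cone_def)
  ultimately have "\<bar>log_slope (A i *v u)\<bar> \<le> slope_bound"
    by (simp add: algebra_simps)
  thus ?thesis
    using assms positive_A by (auto simp: slope_cone_def pos_vec_matrix_mult)
qed

lemma funpow_avg_mono:
  assumes "\<And>u. u \<in> slope_cone \<Longrightarrow> \<Phi> u \<le> (\<Psi> u :: real)" "u \<in> slope_cone"
  shows "(avg ^^ n) \<Phi> u \<le> (avg ^^ n) \<Psi> u"
  using assms(2)
proof (induction n arbitrary: u)
  case (Suc n)
  thus ?case by (auto intro!: avg_mono cone_invariant)
qed (use assms in auto)

section \<open>Convergence of the expected one-step growth\<close>

definition log_growth :: "real^2 \<Rightarrow> real" where
  "log_growth u = avg (\<lambda>v. ln (half_sum v)) u - ln (half_sum u)"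

lemma funpow_log_growth:
  "(avg ^^ n) log_growth u = (avg ^^ Suc n) (\<lambda>v. ln (half_sum v)) u - (avg ^^ n) (\<lambda>v. ln (half_sum v)) u"
  unfolding log_growth_def[abs_def] funpow_avg_diff by (simp add: funpow_swap1)

lemma log_growth_lipschitz:
  assumes "pos_vec u" "pos_vec v"
  shows "\<bar>log_growth u - log_growth v\<bar> \<le> \<bar>log_slope u - log_slope v\<bar>"
proof -
  have eq: "log_growth u = avg (\<lambda>v. ln (half_sum v) - ln (half_sum u)) u" for u
    by (simp add: log_growth_def avg_diff avg_const)
  show ?thesis
    unfolding eq by (intro abs_avg_diff_le ln_half_sum_growth_lipschitz positive_A assms)
qed

text \<open>Each coupled step shrinks the projective distance by \<open>ratio\<close>, so the
  expected growth forgets its starting direction geometrically.\<close>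

lemma funpow_log_growth_lipschitz:
  assumes "pos_vec u" "pos_vec v"
  shows "\<bar>(avg ^^ n) log_growth u - (avg ^^ n) log_growth v\<bar> \<le> ratio ^ n * \<bar>log_slope u - log_slope v\<bar>"
  using assms
proof (induction n arbitrary: u v)
  case 0
  thus ?case by (simp add: log_growth_lipschitz)
next
  case (Suc n)
  have "\<bar>(avg ^^ n) log_growth (A i *v u) - (avg ^^ n) log_growth (A i *v v)\<bar>
      \<le> ratio ^ Suc n * \<bar>log_slope u - log_slope v\<bar>" if i: "i \<in> I" for i
  proof -
    have "\<bar>(avg ^^ n) log_growth (A i *v u) - (avg ^^ n) log_growth (A i *v v)\<bar>
        \<le> ratio ^ n * \<bar>log_slope (A i *v u) - log_slope (A i *v v)\<bar>"
      by (intro Suc.IH pos_vec_matrix_mult positive_A i Suc.prems)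
    also have "\<dots> \<le> ratio ^ n * (ratio * \<bar>log_slope u - log_slope v\<bar>)"
      using ratio_bounds by (intro mult_left_mono log_slope_contraction_family i Suc.prems) auto
    finally show ?thesis by (simp add: mult_ac)
  qed
  thus ?case by (auto intro!: abs_avg_diff_le)
qed

lemma funpow_log_growth_step:
  assumes "u \<in> slope_cone"
  shows "\<bar>(avg ^^ Suc n) log_growth u - (avg ^^ n) log_growth u\<bar> \<le> 2 * slope_bound * ratio ^ n"
proof -
  \<comment> \<open>One further average only moves the starting point from \<open>u\<close> to
    \<open>A i *v u\<close>. Both lie in the cone, so their slopes differ by at most
    \<open>2 * slope_bound\<close>.\<close>
  have "\<bar>(avg ^^ n) log_growth (A i *v u) - (avg ^^ n) log_growth u\<bar> \<le> 2 * slope_bound * ratio ^ n"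
    if i: "i \<in> I" for i
  proof -
    have "A i *v u \<in> slope_cone" using cone_invariant[OF i assms] .
    hence "\<bar>log_slope (A i *v u) - log_slope u\<bar> \<le> 2 * slope_bound"
      using assms unfolding slope_cone_def by auto
    hence "ratio ^ n * \<bar>log_slope (A i *v u) - log_slope u\<bar> \<le> ratio ^ n * (2 * slope_bound)"
      using ratio_bounds by (intro mult_left_mono) auto
    thus ?thesis
      using funpow_log_growth_lipschitz[OF cone_pos cone_pos, OF \<open>A i *v u \<in> slope_cone\<close> assms, of n]
      by (simp add: mult_ac)
  qed
  hence "\<bar>avg ((avg ^^ n) log_growth) u - avg (\<lambda>_. (avg ^^ n) log_growth u) u\<bar> \<le> 2 * slope_bound * ratio ^ n"
    by (intro abs_avg_diff_le) auto
  thus ?thesis by (simp add: avg_const)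
qed

definition rate :: real where
  "rate = lim (\<lambda>n. (avg ^^ n) log_growth 1)"

definition rate_error :: real where
  "rate_error = 2 * slope_bound / (1 - ratio)"

text \<open>Geometric increments give a limit at every point of the cone; the Lipschitz estimate,
  which tends to 0, identifies it with the limit at \<open>1\<close>.\<close>

lemma funpow_log_growth_converges:
  assumes "u \<in> slope_cone"
  shows "(\<lambda>n. (avg ^^ n) log_growth u) \<longlonglongrightarrow> rate"
    and "\<bar>(avg ^^ n) log_growth u - rate\<bar> \<le> rate_error * ratio ^ n"
proof -
  have lim: "\<exists>L. (\<lambda>n. (avg ^^ n) log_growth v) \<longlonglongrightarrow> L \<and>
      (\<forall>n. \<bar>(avg ^^ n) log_growth v - L\<bar> \<le> 2 * slope_bound / (1 - ratio) * ratio ^ n)"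
    if "v \<in> slope_cone" for v
    using funpow_log_growth_step[OF that] ratio_bounds by (intro geometric_increments_limit) auto
  obtain L where L: "(\<lambda>n. (avg ^^ n) log_growth u) \<longlonglongrightarrow> L"
      "\<And>n. \<bar>(avg ^^ n) log_growth u - L\<bar> \<le> rate_error * ratio ^ n"
    using lim[OF assms] unfolding rate_error_def by blast
  have rate: "(\<lambda>n. (avg ^^ n) log_growth 1) \<longlonglongrightarrow> rate"
    using lim[OF one_in_cone] unfolding rate_def convergent_LIMSEQ_iff[symmetric]
    by (auto simp: convergent_def)
  have "(\<lambda>n. ratio ^ n * \<bar>log_slope u - log_slope 1\<bar>) \<longlonglongrightarrow> 0"
    using ratio_bounds by (intro tendsto_mult_left_zero LIMSEQ_realpow_zero) auto
  hence "(\<lambda>n. (avg ^^ n) log_growth u - (avg ^^ n) log_growth 1) \<longlonglongrightarrow> 0"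
    by (rule Lim_null_comparison[rotated])
       (simp add: funpow_log_growth_lipschitz[OF cone_pos[OF assms] pos_vec_one] always_eventually)
  with rate have "(\<lambda>n. (avg ^^ n) log_growth u) \<longlonglongrightarrow> rate"
    by (rule Lim_transform)
  hence "L = rate" using L(1) LIMSEQ_unique by blast
  with L show "(\<lambda>n. (avg ^^ n) log_growth u) \<longlonglongrightarrow> rate"
    and "\<bar>(avg ^^ n) log_growth u - rate\<bar> \<le> rate_error * ratio ^ n" by auto
qed

section \<open>The Poisson equation for the logarithmic growth\<close>
text \<open>The resolvent series solving the Poisson equation
  \<open>corrector - avg corrector = log_growth - rate\<close> on the cone.\<close>

definition corrector :: "real^2 \<Rightarrow> real" where
  "corrector u = (\<Sum>n. (avg ^^ n) log_growth u - rate)"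

definition potential :: "real^2 \<Rightarrow> real" where
  "potential u = ln (half_sum u) + corrector u"

lemma corrector_summable:
  assumes "u \<in> slope_cone"
  shows "summable (\<lambda>n. (avg ^^ n) log_growth u - rate)"
    and "\<bar>corrector u\<bar> \<le> rate_error / (1 - ratio)"
proof -
  have le: "\<And>n. norm ((avg ^^ n) log_growth u - rate) \<le> rate_error * ratio ^ n"
    using funpow_log_growth_converges(2)[OF assms] by simp
  have geo: "(\<lambda>n. rate_error * ratio ^ n) sums (rate_error * (1 / (1 - ratio)))"
    using ratio_bounds by (intro sums_mult geometric_sums) auto
  show "summable (\<lambda>n. (avg ^^ n) log_growth u - rate)"
    using le by (intro summable_comparison_test[OF _ sums_summable[OF geo]]) auto
  show "\<bar>corrector u\<bar> \<le> rate_error / (1 - ratio)"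
    using norm_suminf_le[OF le sums_summable[OF geo]] sums_unique[OF geo]
    by (simp add: corrector_def)
qed

text \<open>Averaging shifts the corrector series by one index and so removes its first term
  \<open>log_growth u - rate\<close>. Averaging \<open>ln (half_sum u)\<close> adds
  \<open>log_growth u\<close>, and only the drift \<open>rate\<close> is left.\<close>

lemma avg_potential:
  assumes "u \<in> slope_cone"
  shows "avg potential u = potential u + rate"
proof -
  let ?D = "\<lambda>n u. (avg ^^ n) log_growth u - rate"
  have "avg corrector u = (\<Sum>i\<in>I. \<Sum>n. w i * ?D n (A i *v u))"
    unfolding avg_def[of corrector] corrector_def real_scaleR_def
    by (intro sum.cong refl suminf_mult[symmetric] corrector_summable(1) cone_invariant assms)
  also have "\<dots> = (\<Sum>n. \<Sum>i\<in>I. w i * ?D n (A i *v u))"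
    by (intro suminf_sum[symmetric] summable_mult corrector_summable(1) cone_invariant assms)
  also have "\<dots> = (\<Sum>n. avg (\<lambda>u. ?D n u) u)"
    by (simp add: avg_def)
  also have "\<dots> = (\<Sum>n. ?D (Suc n) u)"
    by (simp add: avg_diff avg_const)
  also have "\<dots> = corrector u - ?D 0 u"
    unfolding corrector_def by (rule suminf_split_head[OF corrector_summable(1)[OF assms]])
  finally show ?thesis
    by (simp add: potential_def[abs_def] avg_add log_growth_def)
qed

definition increment_bound :: real where
  "increment_bound = (\<Sum>i\<in>I. \<bar>ln (half_sum (A i *v 1))\<bar>) + slope_bound + 2 * (rate_error / (1 - ratio)) + \<bar>rate\<bar>"

text \<open>The growth at \<open>u\<close> is compared with the growth at \<open>1\<close>, at cost
  \<open>slope_bound\<close>; the two corrector values and the drift supply the remaining terms of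
  \<open>increment_bound\<close>.\<close>

lemma potential_increment:
  assumes "i \<in> I" "u \<in> slope_cone"
  shows "\<bar>potential (A i *v u) - potential u - rate\<bar> \<le> increment_bound"
proof -
  have "\<bar>ln (half_sum (A i *v 1))\<bar> \<le> (\<Sum>i\<in>I. \<bar>ln (half_sum (A i *v 1))\<bar>)"
    using finite_I assms by (intro member_le_sum) auto
  moreover have "\<bar>(ln (half_sum (A i *v u)) - ln (half_sum u)) - ln (half_sum (A i *v 1))\<bar> \<le> slope_bound"
    using ln_half_sum_growth_lipschitz[OF positive_A[OF assms(1)] cone_pos[OF assms(2)] pos_vec_one] assms(2)
    by (simp add: slope_cone_def log_slope_one half_sum_def)
  moreover have "\<bar>corrector u\<bar> \<le> rate_error / (1 - ratio)"
    "\<bar>corrector (A i *v u)\<bar> \<le> rate_error / (1 - ratio)"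
    by (intro corrector_summable(2) cone_invariant assms)+
  ultimately show ?thesis
    unfolding potential_def increment_bound_def by linarith
qed

section \<open>Moments of the deviation\<close>
text \<open>Along the walk from \<open>1\<close> this is a martingale with initial value 0.\<close>

definition deviation :: "nat \<Rightarrow> real^2 \<Rightarrow> real" where
  "deviation n u = potential u - potential 1 - real n * rate"

text \<open>One step replaces the deviation Y by Y + d with d of mean 0 and size at most K, so terms
  linear in d drop out. For the fourth power, splitting the term 4 Y d^3 turns the coefficients 6
  and 1 of Y^2 d^2 and d^4 into 8 and 3.\<close>

lemma avg_deviation_moments:
  assumes u: "u \<in> slope_cone"
  shows "avg (\<lambda>v. deviation (Suc n) v ^ 2) u \<le> deviation n u ^ 2 + increment_bound ^ 2"
    and "avg (\<lambda>v. deviation (Suc n) v ^ 4) u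
      \<le> deviation n u ^ 4 + 8 * increment_bound ^ 2 * deviation n u ^ 2 + 3 * increment_bound ^ 4"
proof -
  let ?Y = "deviation n u" and ?K = increment_bound
  define d where "d i = potential (A i *v u) - potential u - rate" for i
  have dev: "deviation (Suc n) (A i *v u) = ?Y + d i" for i
    by (simp add: deviation_def d_def algebra_simps)
  have mean: "(\<Sum>i\<in>I. w i * d i) = 0"
  proof -
    have "(\<Sum>i\<in>I. w i * d i) = avg (\<lambda>v. potential v - (potential u + rate)) u"
      by (simp add: avg_def d_def diff_diff_eq)
    thus ?thesis by (simp add: avg_diff avg_const avg_potential[OF u])
  qed
  have d: "\<bar>d i\<bar> \<le> ?K" if "i \<in> I" for i
    using potential_increment[OF that u] by (simp add: d_def)
  have d2: "d i ^ 2 \<le> ?K ^ 2" if "i \<in> I" for i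
    using power_mono[OF d[OF that], of 2] by simp
  \<comment> \<open>The pointwise upper bounds below have this shape; \<open>a\<close> and
    \<open>c\<close> do not depend on the letter and the middle term has mean 0.\<close>
  have weighted: "(\<Sum>i\<in>I. w i * (a + b * d i + c)) = a + c" for a b c
  proof -
    have "(\<Sum>i\<in>I. w i * (a + b * d i + c)) = (\<Sum>i\<in>I. w i) * (a + c) + b * (\<Sum>i\<in>I. w i * d i)"
      by (simp add: sum_distrib_left sum_distrib_right sum.distrib[symmetric] algebra_simps)
    thus ?thesis by (simp add: mean weight_sum)
  qed
  have "avg (\<lambda>v. deviation (Suc n) v ^ 2) u \<le> (\<Sum>i\<in>I. w i * (?Y ^ 2 + 2 * ?Y * d i + ?K ^ 2))"
    unfolding avg_def real_scaleR_def dev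
  proof (intro sum_mono mult_left_mono)
    fix i assume i: "i \<in> I"
    show "(?Y + d i)\<^sup>2 \<le> ?Y\<^sup>2 + 2 * ?Y * d i + ?K\<^sup>2"
      using d2[OF i] by (simp add: power2_sum)
  qed (use weight_pos in \<open>auto simp: less_imp_le\<close>)
  thus "avg (\<lambda>v. deviation (Suc n) v ^ 2) u \<le> ?Y ^ 2 + ?K ^ 2"
    by (simp add: weighted)
  have "avg (\<lambda>v. deviation (Suc n) v ^ 4) u
      \<le> (\<Sum>i\<in>I. w i * (?Y ^ 4 + 4 * ?Y ^ 3 * d i + (8 * ?K ^ 2 * ?Y ^ 2 + 3 * ?K ^ 4)))"
    unfolding avg_def real_scaleR_def dev
  proof (intro sum_mono mult_left_mono)
    fix i assume i: "i \<in> I"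
    (* AM-GM removes the odd term whose conditional mean does not vanish *)
    have "4 * ?Y * d i ^ 3 \<le> 2 * ?Y ^ 2 * d i ^ 2 + 2 * d i ^ 4"
    proof -
      have "0 \<le> 2 * (d i * (?Y - d i)) ^ 2" by simp
      thus ?thesis by (simp add: power2_eq_square power3_eq_cube power4_eq_xxxx algebra_simps)
    qed
    moreover have "(?Y + d i) ^ 4 = ?Y ^ 4 + 4 * ?Y ^ 3 * d i + 6 * ?Y ^ 2 * d i ^ 2 + 4 * ?Y * d i ^ 3 + d i ^ 4"
      by (simp add: power2_eq_square power3_eq_cube power4_eq_xxxx algebra_simps)
    moreover have "?Y ^ 2 * d i ^ 2 \<le> ?Y ^ 2 * ?K ^ 2"
      using d2[OF i] by (intro mult_left_mono) auto
    moreover have "d i ^ 4 \<le> ?K ^ 4"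
      using power_mono[OF d2[OF i], of 2] by simp
    ultimately show "(?Y + d i) ^ 4 \<le> ?Y ^ 4 + 4 * ?Y ^ 3 * d i + (8 * ?K ^ 2 * ?Y ^ 2 + 3 * ?K ^ 4)"
      by (simp add: mult_ac)
  qed (use weight_pos in \<open>auto simp: less_imp_le\<close>)
  thus "avg (\<lambda>v. deviation (Suc n) v ^ 4) u \<le> ?Y ^ 4 + 8 * ?K ^ 2 * ?Y ^ 2 + 3 * ?K ^ 4"
    by (simp add: weighted)
qed

lemma second_moment_deviation:
  "(avg ^^ n) (\<lambda>u. deviation n u ^ 2) 1 \<le> real n * increment_bound ^ 2"
proof (induction n)
  case 0
  thus ?case by (simp add: deviation_def)
next
  case (Suc n)
  have "(avg ^^ Suc n) (\<lambda>u. deviation (Suc n) u ^ 2) 1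
      \<le> (avg ^^ n) (\<lambda>u. deviation n u ^ 2 + increment_bound ^ 2) 1"
    \<comment> \<open>The innermost \<open>avg\<close> is the last random step, so the one-step
      estimate acts conditionally on the state after \<open>n\<close> steps.\<close>
    unfolding funpow_Suc_right o_apply
    by (intro funpow_avg_mono avg_deviation_moments one_in_cone)
  thus ?case
    using Suc.IH by (simp add: funpow_avg_add funpow_avg_const algebra_simps)
qed

lemma fourth_moment_deviation:
  "(avg ^^ n) (\<lambda>u. deviation n u ^ 4) 1 \<le> 8 * increment_bound ^ 4 * real n ^ 2"
proof (induction n)
  case 0
  thus ?case by (simp add: deviation_def)
next
  case (Suc n)
  let ?K = increment_bound
  have "(avg ^^ Suc n) (\<lambda>u. deviation (Suc n) u ^ 4) 1
      \<le> (avg ^^ n) (\<lambda>u. deviation n u ^ 4 + 8 * ?K ^ 2 * deviation n u ^ 2 + 3 * ?K ^ 4) 1"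
    unfolding funpow_Suc_right o_apply
    by (intro funpow_avg_mono avg_deviation_moments one_in_cone)
  also have "\<dots> \<le> 8 * ?K ^ 4 * real n ^ 2 + 8 * ?K ^ 2 * (real n * ?K ^ 2) + 3 * ?K ^ 4"
    unfolding funpow_avg_add funpow_avg_cmult funpow_avg_const
    by (intro add_mono Suc.IH mult_left_mono second_moment_deviation) auto
  also have "\<dots> \<le> 8 * ?K ^ 4 * real (Suc n) ^ 2"
  proof -
    \<comment> \<open>The slack in the recursion, as a polynomial identity to be used with
      \<open>s = increment_bound ^ 2\<close> and \<open>x = real n\<close>.\<close>
    have "8 * (s * s) * (1 + x) ^ 2 - (8 * (s * s) * x ^ 2 + 8 * s * (x * s) + 3 * (s * s)) = s * s * (8 * x + 5)"
      for s x :: real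
      by (simp add: power2_eq_square algebra_simps)
    from this[of "?K ^ 2" "real n"]
    have "8 * ?K ^ 4 * real (Suc n) ^ 2 - (8 * ?K ^ 4 * real n ^ 2 + 8 * ?K ^ 2 * (real n * ?K ^ 2) + 3 * ?K ^ 4)
        = ?K ^ 4 * (8 * real n + 5)"
      by (simp add: power_add[symmetric])
    moreover have "0 \<le> ?K ^ 4 * (8 * real n + 5)" by simp
    ultimately show ?thesis by linarith
  qed
  finally show ?case .
qed
end

section \<open>The almost sure growth rate\<close>

lemma matrix_cocycle_cong:
  "(\<And>k. k \<in> {1..n} \<Longrightarrow> \<omega> k = \<omega>' k) \<Longrightarrow> matrix_cocycle A \<omega> n = matrix_cocycle A \<omega>' n"
  by (induction n) auto

lemma summable_power4_tendsto:
  fixes x :: "nat \<Rightarrow> real"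
  assumes "summable (\<lambda>n. x n ^ 4)"
  shows "x \<longlonglongrightarrow> 0"
proof -
  have "(\<lambda>n. sqrt (sqrt (x n ^ 4))) \<longlonglongrightarrow> sqrt (sqrt 0)"
    by (intro tendsto_real_sqrt summable_LIMSEQ_zero assms)
  moreover have "sqrt (sqrt (y ^ 4)) = \<bar>y\<bar>" for y :: real
  proof -
    have "y ^ 4 = (y ^ 2) ^ 2" by simp
    thus ?thesis by (simp only: real_sqrt_abs abs_power2)
  qed
  ultimately show ?thesis by (simp add: tendsto_rabs_zero_iff)
qed

lemma bounded_over_n_tendsto:
  fixes b :: "nat \<Rightarrow> real"
  assumes "\<And>n. \<bar>b n\<bar> \<le> K"
  shows "(\<lambda>n. b n / real n) \<longlonglongrightarrow> 0"
proof (rule Lim_null_comparison)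
  show "\<forall>\<^sub>F n in sequentially. norm (b n / real n) \<le> K / real n"
    using assms by (auto intro!: always_eventually divide_right_mono)
  show "(\<lambda>n. K / real n) \<longlonglongrightarrow> 0"
    by (rule lim_const_over_n)
qed

lemma half_sum_mult_one:
  fixes B :: "real^2^2"
  shows "half_sum (B *v 1) = (B $ 1 $ 1 + B $ 1 $ 2 + B $ 2 $ 1 + B $ 2 $ 2) / 2"
  by (simp add: half_sum_def matrix_vector_mult_2)

text \<open>The entry sum of a nonnegative matrix is twice \<open>half_sum (B *v 1)\<close>. It
  bounds the Frobenius norm from above, and each of the four entries is at most the norm, so norm
  and half sum agree up to a factor 2.\<close>

lemma ln_norm_half_sum:
  fixes B :: "real^2^2"
  assumes nonneg: "\<And>i j. 0 \<le> B $ i $ j" and pos: "0 < half_sum (B *v 1)"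
  shows "\<bar>ln (norm B) - ln (half_sum (B *v 1))\<bar> \<le> ln 2"
proof -
  have "norm B \<le> (\<Sum>i\<in>UNIV. norm (B $ i))"
    by (simp add: norm_vec_def L2_set_le_sum)
  also have "\<dots> \<le> (\<Sum>i\<in>UNIV. \<Sum>j\<in>UNIV. \<bar>B $ i $ j\<bar>)"
    by (intro sum_mono norm_le_l1_cart)
  also have "\<dots> = 2 * half_sum (B *v 1)"
    using nonneg by (simp add: sum_2 half_sum_mult_one)
  finally have upper: "norm B \<le> 2 * half_sum (B *v 1)" .
  have "B $ i $ j \<le> norm B" for i j
    using component_le_norm_cart[of "B $ i" j] Finite_Cartesian_Product.norm_nth_le[of B i] nonneg[of i j]
    by simp
  from this[of 1 1] this[of 1 2] this[of 2 1] this[of 2 2]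
  have lower: "half_sum (B *v 1) \<le> 2 * norm B"
    by (simp add: half_sum_mult_one)
  have norm_pos: "0 < norm B" using lower pos by linarith
  have "ln (norm B) \<le> ln 2 + ln (half_sum (B *v 1))"
    using ln_mono[OF upper norm_pos] pos by (simp add: ln_mult)
  moreover have "ln (half_sum (B *v 1)) \<le> ln 2 + ln (norm B)"
    using ln_mono[OF lower pos] norm_pos by (simp add: ln_mult)
  ultimately show ?thesis by linarith
qed

section \<open>The Bernoulli measure and its finite-step expectations\<close>

context positive_matrix_family begin

abbreviation letter_measure :: "'i measure" where
  "letter_measure \<equiv> point_measure I (\<lambda>i. ennreal (w i))"

lemma prob_space_letter: "prob_space letter_measure"
proof (rule prob_spaceI)
  have "(\<Sum>i\<in>I. ennreal (w i)) = 1"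
    using weight_pos weight_sum by (simp add: sum_ennreal less_imp_le)
  thus "emeasure letter_measure (space letter_measure) = 1"
    by (simp add: space_point_measure emeasure_point_measure_finite finite_I)
qed

lemma product_prob_space_letter: "product_prob_space (\<lambda>_. letter_measure)"
  using prob_space_letter
  by (simp add: product_prob_space_def product_prob_space_axioms_def product_sigma_finite_def
      prob_space_imp_sigma_finite)

lemma prob_space_bernoulli: "prob_space (bernoulli_measure I w)"
  unfolding bernoulli_measure_def by (intro prob_space_PiM prob_space_letter)

text \<open>With the discrete sigma-algebra as target, every function of the matrix product is
  measurable as well. The step works because the new letter ranges over a finite set.\<close>

lemma matrix_cocycle_measurable:
  assumes "{1..n} \<subseteq> J"
  shows "(\<lambda>\<omega>. matrix_cocycle A \<omega> n) \<in> measurable (PiM J (\<lambda>_. letter_measure)) (count_space UNIV)"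
  using assms
proof (induction n)
  case 0
  thus ?case by simp
next
  case (Suc n)
  have "(\<lambda>\<omega>. \<omega> (Suc n)) \<in> measurable (PiM J (\<lambda>_. letter_measure)) letter_measure"
    using Suc.prems by (intro measurable_component_singleton) auto
  also have "\<dots> = measurable (PiM J (\<lambda>_. letter_measure)) (count_space I)"
    by (intro measurable_cong_sets) (simp_all add: sets_point_measure)
  finally have letter: "(\<lambda>\<omega>. \<omega> (Suc n)) \<in> measurable (PiM J (\<lambda>_. letter_measure)) (count_space I)" .
  have prev: "(\<lambda>\<omega>. matrix_cocycle A \<omega> n) \<in> measurable (PiM J (\<lambda>_. letter_measure)) (count_space UNIV)"
    using Suc.prems by (intro Suc.IH) (auto simp: atLeastAtMostSuc_conv)
  have "(\<lambda>\<omega>. A (\<omega> (Suc n)) ** matrix_cocycle A \<omega> n)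
      \<in> measurable (PiM J (\<lambda>_. letter_measure)) (count_space UNIV)"
    by (rule measurable_compose_countable'[OF measurable_compose[OF prev] letter])
       (use finite_I in \<open>auto intro: countable_finite\<close>)
  thus ?case by simp
qed

text \<open>Integrating out the last letter replaces \<open>\<Phi>\<close> by
  \<open>avg \<Phi>\<close>, so the induction on \<open>n\<close> runs over all nonnegative
  \<open>\<Phi>\<close>.\<close>

lemma nn_integral_state_finite:
  assumes "\<And>u. 0 \<le> \<Phi> u"
  shows "(\<integral>\<^sup>+\<omega>. ennreal (\<Phi> (matrix_cocycle A \<omega> n *v 1)) \<partial>PiM {1..n} (\<lambda>_. letter_measure))
    = ennreal ((avg ^^ n) \<Phi> 1)"
  using assms
proof (induction n arbitrary: \<Phi>)
  case 0
  interpret P: product_prob_space "\<lambda>_::nat. letter_measure" "{}" by (rule product_prob_space_letter)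
  show ?case using P.emeasure_space_1 by (simp add: matrix_vector_mul_lid)
next
  case (Suc n)
  interpret P: product_prob_space "\<lambda>_::nat. letter_measure" "{1..n}" by (rule product_prob_space_letter)
  have meas: "(\<lambda>\<omega>. ennreal (\<Phi> (matrix_cocycle A \<omega> (Suc n) *v 1)))
      \<in> borel_measurable (PiM {1..Suc n} (\<lambda>_. letter_measure))"
    by (rule measurable_compose[OF matrix_cocycle_measurable]) auto
  have set: "{1..Suc n} = insert (Suc n) {1..n}" by auto
  have avg_nonneg: "0 \<le> avg \<Phi> u" for u
    unfolding avg_def using weight_pos Suc.prems by (auto intro!: sum_nonneg simp: less_imp_le)
  have step: "(\<integral>\<^sup>+i. ennreal (\<Phi> (matrix_cocycle A (fun_upd \<omega> (Suc n) i) (Suc n) *v 1)) \<partial>letter_measure)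
      = ennreal (avg \<Phi> (matrix_cocycle A \<omega> n *v 1))" for \<omega>
  proof -
    have "matrix_cocycle A (fun_upd \<omega> (Suc n) i) n = matrix_cocycle A \<omega> n" for i
      by (rule matrix_cocycle_cong) auto
    hence "(\<integral>\<^sup>+i. ennreal (\<Phi> (matrix_cocycle A (fun_upd \<omega> (Suc n) i) (Suc n) *v 1)) \<partial>letter_measure)
        = (\<Sum>i\<in>I. ennreal (w i) * ennreal (\<Phi> (A i *v (matrix_cocycle A \<omega> n *v 1))))"
      by (simp add: nn_integral_point_measure_finite finite_I matrix_vector_mul_assoc)
    also have "\<dots> = (\<Sum>i\<in>I. ennreal (w i * \<Phi> (A i *v (matrix_cocycle A \<omega> n *v 1))))"
      using weight_pos Suc.prems by (intro sum.cong refl ennreal_mult[symmetric]) (auto simp: less_imp_le)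
    also have "\<dots> = ennreal (avg \<Phi> (matrix_cocycle A \<omega> n *v 1))"
      unfolding avg_def real_scaleR_def using weight_pos Suc.prems
      by (intro sum_ennreal) (auto simp: less_imp_le)
    finally show ?thesis .
  qed
  have "(\<integral>\<^sup>+\<omega>. ennreal (\<Phi> (matrix_cocycle A \<omega> (Suc n) *v 1)) \<partial>PiM {1..Suc n} (\<lambda>_. letter_measure))
      = (\<integral>\<^sup>+\<omega>. ennreal (avg \<Phi> (matrix_cocycle A \<omega> n *v 1)) \<partial>PiM {1..n} (\<lambda>_. letter_measure))"
    unfolding step[symmetric] set
    by (rule P.product_nn_integral_insert[OF _ _ meas[unfolded set]]) auto
  thus ?case
    using Suc.IH[of "avg \<Phi>", OF avg_nonneg] by (simp only: funpow_Suc_right o_apply)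
qed

lemma nn_integral_state:
  assumes "\<And>u. 0 \<le> \<Phi> u"
  shows "(\<integral>\<^sup>+\<omega>. ennreal (\<Phi> (matrix_cocycle A \<omega> n *v 1)) \<partial>bernoulli_measure I w) = ennreal ((avg ^^ n) \<Phi> 1)"
proof -
  interpret P: product_prob_space "\<lambda>_::nat. letter_measure" "{1..}" by (rule product_prob_space_letter)
  have meas: "(\<lambda>\<omega>. ennreal (\<Phi> (matrix_cocycle A \<omega> n *v 1))) \<in> borel_measurable (PiM {1..n} (\<lambda>_. letter_measure))"
    by (rule measurable_compose[OF matrix_cocycle_measurable]) auto
  \<comment> \<open>Only the first \<open>n\<close> letters matter, so the infinite product may be
    replaced by its finite marginal.\<close>
  have "matrix_cocycle A (restrict \<omega> {1..n}) n = matrix_cocycle A \<omega> n" for \<omega>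
    by (rule matrix_cocycle_cong) auto
  hence "(\<integral>\<^sup>+\<omega>. ennreal (\<Phi> (matrix_cocycle A \<omega> n *v 1)) \<partial>bernoulli_measure I w)
      = (\<integral>\<^sup>+\<omega>. ennreal (\<Phi> (matrix_cocycle A \<omega> n *v 1))
          \<partial>distr (PiM {1..} (\<lambda>_. letter_measure)) (PiM {1..n} (\<lambda>_. letter_measure)) (\<lambda>\<omega>. restrict \<omega> {1..n}))"
    unfolding bernoulli_measure_def
    by (subst nn_integral_distr[OF measurable_restrict_subset])
       (simp_all only: measurable_distr_eq1 meas, auto)
  thus ?thesis
    by (subst (asm) P.distr_PiM_restrict_finite) (simp_all only: nn_integral_state_finite[of \<Phi>, OF assms], auto)
qed

text \<open>The fourth moment of \<open>deviation n / n\<close> is of order \<open>1 / n^2\<close>,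
  which is summable. Hence the sum of the fourth powers has finite expectation, is almost surely
  finite, and its terms tend to 0.\<close>

lemma AE_deviation:
  "AE \<omega> in bernoulli_measure I w. (\<lambda>n. deviation n (matrix_cocycle A \<omega> n *v 1) / real n) \<longlonglongrightarrow> 0"
proof -
  let ?\<mu> = "bernoulli_measure I w" and ?K = "increment_bound"
  let ?X = "\<lambda>n \<omega>. (deviation n (matrix_cocycle A \<omega> n *v 1) / real n) ^ 4"
  have meas: "(\<lambda>\<omega>. ennreal (?X n \<omega>)) \<in> borel_measurable ?\<mu>" for n
    unfolding bernoulli_measure_def
    by (rule measurable_compose[OF matrix_cocycle_measurable]) auto
  have le: "(\<integral>\<^sup>+\<omega>. ennreal (?X n \<omega>) \<partial>?\<mu>) \<le> ennreal (8 * ?K ^ 4 * (1 / real n ^ 2))" for n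
  \<comment> \<open>At \<open>n = 0\<close> both sides are 0, because division by 0 gives 0.\<close>
  proof (cases "n = 0")
    case False
    have "(\<integral>\<^sup>+\<omega>. ennreal (?X n \<omega>) \<partial>?\<mu>) = ennreal ((avg ^^ n) (\<lambda>u. (1 / real n ^ 4) * deviation n u ^ 4) 1)"
      by (subst nn_integral_state[symmetric]) (auto simp: power_divide)
    also have "(avg ^^ n) (\<lambda>u. (1 / real n ^ 4) * deviation n u ^ 4) 1 \<le> 1 / real n ^ 4 * (8 * ?K ^ 4 * real n ^ 2)"
      unfolding funpow_avg_cmult by (intro mult_left_mono fourth_moment_deviation) auto
    also have "\<dots> = 8 * ?K ^ 4 * (1 / real n ^ 2)"
      using False by (simp add: field_simps power_add[symmetric])
    finally show ?thesis by (simp add: ennreal_leI)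
  qed simp
  have "(\<integral>\<^sup>+\<omega>. (\<Sum>n. ennreal (?X n \<omega>)) \<partial>?\<mu>) = (\<Sum>n. \<integral>\<^sup>+\<omega>. ennreal (?X n \<omega>) \<partial>?\<mu>)"
    by (intro nn_integral_suminf meas)
  also have "\<dots> \<le> (\<Sum>n. ennreal (8 * ?K ^ 4 * (1 / real n ^ 2)))"
    by (intro suminf_le le) auto
  also have "\<dots> < \<top>"
    unfolding less_top[symmetric]
    by (intro ennreal_suminf_neq_top summable_mult inverse_power_summable[of 2, unfolded inverse_eq_divide]) auto
  finally have "(\<integral>\<^sup>+\<omega>. (\<Sum>n. ennreal (?X n \<omega>)) \<partial>?\<mu>) \<noteq> \<infinity>"
    by (auto simp: top_unique)
  hence "AE \<omega> in ?\<mu>. (\<Sum>n. ennreal (?X n \<omega>)) \<noteq> \<infinity>"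
    by (intro nn_integral_PInf_AE borel_measurable_suminf_order meas)
  thus ?thesis
    by eventually_elim (auto intro!: summable_power4_tendsto summable_suminf_not_top)
qed

lemma matrix_cocycle_admissible:
  assumes "\<And>k. 1 \<le> k \<Longrightarrow> \<omega> k \<in> I"
  shows "matrix_cocycle A \<omega> n *v 1 \<in> slope_cone" "0 \<le> matrix_cocycle A \<omega> n $ i $ j"
proof -
  show "matrix_cocycle A \<omega> n *v 1 \<in> slope_cone"
  proof (induction n)
    case (Suc n)
    thus ?case using cone_invariant[OF assms] by (simp add: matrix_vector_mul_assoc[symmetric])
  qed (simp add: matrix_vector_mul_lid one_in_cone)
  show "0 \<le> matrix_cocycle A \<omega> n $ i $ j"
  proof (induction n arbitrary: i j)
    case 0
    thus ?case by (simp add: mat_def)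
  next
    case (Suc n)
    have "0 \<le> A (\<omega> (Suc n)) $ i $ k" for k
      using positive_A[OF assms[of "Suc n"]] by (simp add: positive_matrix_def less_imp_le)
    thus ?case using Suc by (auto simp: matrix_matrix_mult_def intro!: sum_nonneg)
  qed
qed

lemma AE_log_norm_cocycle:
  "AE \<omega> in bernoulli_measure I w. (\<lambda>n. 1 / real n * ln (norm (matrix_cocycle A \<omega> n))) \<longlonglongrightarrow> rate"
  using AE_deviation AE_space
proof eventually_elim
  case (elim \<omega>)
  have admissible: "\<And>k. 1 \<le> k \<Longrightarrow> \<omega> k \<in> I"
    using elim(2) by (auto simp: bernoulli_measure_def space_PiM space_point_measure PiE_def)
  note adm = matrix_cocycle_admissible[where \<omega> = \<omega>, OF admissible]
  let ?S = "\<lambda>n. matrix_cocycle A \<omega> n *v 1"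
  \<comment> \<open>The bounded error between the logarithm of the norm and the martingale:
    \<open>deviation n + b n + n * rate\<close> is exactly the former.\<close>
  define b where "b n = ln (norm (matrix_cocycle A \<omega> n)) - ln (half_sum (?S n)) - corrector (?S n) + potential 1" for n
  have "\<bar>b n\<bar> \<le> ln 2 + rate_error / (1 - ratio) + \<bar>potential 1\<bar>" for n
    using ln_norm_half_sum[OF adm(2) half_sum_pos[OF cone_pos[OF adm(1)]], of n] corrector_summable(2)[OF adm(1), of n]
    unfolding b_def by (smt (verit))
  hence "(\<lambda>n. deviation n (?S n) / real n + b n / real n + rate) \<longlonglongrightarrow> 0 + 0 + rate"
    by (intro tendsto_add tendsto_const elim(1) bounded_over_n_tendsto)
  moreover have "\<forall>\<^sub>F n in sequentially. deviation n (?S n) / real n + b n / real n + rate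
      = 1 / real n * ln (norm (matrix_cocycle A \<omega> n))"
    using eventually_gt_at_top[of 0]
    by eventually_elim (simp add: deviation_def potential_def b_def field_simps)
  ultimately show ?case by (simp add: tendsto_cong)
qed

lemma top_lyapunov_exponent_eq_rate: "top_lyapunov_exponent I w A = rate"
  unfolding top_lyapunov_exponent_def
proof (rule the_equality, rule AE_log_norm_cocycle)
  \<comment> \<open>Total mass 1 makes an almost sure equality of two constants a true one, which
    yields uniqueness of the limit value.\<close>
  interpret prob_space "bernoulli_measure I w" by (rule prob_space_bernoulli)
  fix L
  assume "AE \<omega> in bernoulli_measure I w. (\<lambda>n. 1 / real n * ln (norm (matrix_cocycle A \<omega> n))) \<longlonglongrightarrow> L"
  with AE_log_norm_cocycle have "AE \<omega> in bernoulli_measure I w. L = rate"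
    by eventually_elim (rule LIMSEQ_unique)
  thus "L = rate" by simp
qed

end

section \<open>Row sums of the infinite matrix\<close>

lemma negative_binomial_sums:
  fixes z :: complex
  assumes "norm z < 1"
  shows "(\<lambda>m. of_nat ((m + r) choose r) * z ^ m) sums (1 / (1 - z) ^ Suc r)"
proof -
  have coeff: "((- of_nat (Suc r) :: complex) gchoose m) = (-1) ^ m * of_nat ((m + r) choose r)" for m
  proof -
    have "((- of_nat (Suc r) :: complex) gchoose m) = (-1) ^ m * (of_nat (m + r) gchoose m)"
      by (subst gbinomial_minus) (simp add: algebra_simps)
    also have "(of_nat (m + r) gchoose m) = (of_nat ((m + r) choose m) :: complex)"
      by (simp add: binomial_gbinomial)
    also have "(m + r) choose m = (m + r) choose r"
      using binomial_symmetric[of m "m + r"] by simp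
    finally show ?thesis .
  qed
  have "(\<lambda>m. ((- of_nat (Suc r) :: complex) gchoose m) * (- z) ^ m) sums (1 + - z) powr (- of_nat (Suc r))"
    using assms by (intro gen_binomial_complex) simp
  moreover have "((- of_nat (Suc r) :: complex) gchoose m) * (- z) ^ m = of_nat ((m + r) choose r) * z ^ m" for m
    unfolding coeff using power_mult_distrib[of "-1" "- z" m] by (simp add: mult_ac)
  moreover have "(1 + - z) powr (- of_nat (Suc r)) = 1 / (1 - z) ^ Suc r"
  proof -
    have "1 - z \<noteq> 0" using assms by auto
    hence "(1 - z) powr of_nat (Suc r) = (1 - z) ^ Suc r"
      by (rule powr_nat'[OF disjI1])
    thus ?thesis by (simp only: powr_minus_divide diff_conv_add_uminus[symmetric])
  qed
  ultimately show ?thesis by (simp only:)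
qed

text \<open>The factor 1/n from \<open>vseq\<close> is absorbed by C(n,l)/n = C(n-1,l-1)/l. After
  the shift n = m + l a negative binomial series with ratio \<open>- (a * x)\<close>
  remains.\<close>

lemma binomial_column_sums:
  fixes a x :: complex
  assumes "norm (a * x) < 1" "l \<ge> 1"
  shows "(\<lambda>n. of_nat (n choose l) * a ^ (n - l) * vseq x c n) sums (- (1 / of_nat l * (- x / (1 + a * x)) ^ l))"
proof -
  obtain r where l: "l = Suc r" using assms(2) by (cases l) auto
  have term_eq: "of_nat ((m + l) choose l) * a ^ (m + l - l) * vseq x c (m + l)
      = - (1 / of_nat l * (- x) ^ l) * (of_nat ((m + r) choose r) * (- (a * x)) ^ m)" for m
  proof -
    have "Suc r * ((m + l) choose l) = (m + l) * ((m + r) choose r)"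
      using Suc_times_binomial_eq[of "m + r" r] unfolding l by (simp add: mult_ac)
    hence "of_nat (Suc r) * of_nat ((m + l) choose l) = of_nat (m + l) * (of_nat ((m + r) choose r) :: complex)"
      by (simp only: of_nat_mult[symmetric])
    moreover have "of_nat (Suc r) \<noteq> (0 :: complex)" by (simp only: of_nat_eq_0_iff)
    moreover have "of_nat (m + l) \<noteq> (0 :: complex)" unfolding l by (simp only: of_nat_eq_0_iff)
    ultimately have "of_nat ((m + l) choose l) / of_nat (m + l) = (of_nat ((m + r) choose r) / of_nat l :: complex)"
      unfolding l by (metis frac_eq_eq mult.commute)
    moreover have "of_nat ((m + l) choose l) * a ^ (m + l - l) * vseq x c (m + l)
        = - (of_nat ((m + l) choose l) / of_nat (m + l)) * (a ^ m * (- x) ^ m * (- x) ^ l)"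
      by (simp add: vseq_def l power_add)
    moreover have "a ^ m * (- x) ^ m = (- (a * x)) ^ m"
      by (simp add: power_mult_distrib[symmetric])
    ultimately show ?thesis by simp
  qed
  have "(\<lambda>m. - (1 / of_nat l * (- x) ^ l) * (of_nat ((m + r) choose r) * (- (a * x)) ^ m))
      sums (- (1 / of_nat l * (- x) ^ l) * (1 / (1 - - (a * x)) ^ Suc r))"
    using assms by (intro sums_mult negative_binomial_sums) simp
  also have "- (1 / of_nat l * (- x) ^ l) * (1 / (1 - - (a * x)) ^ Suc r) = - (1 / of_nat l * (- x / (1 + a * x)) ^ l)"
    by (simp only: l power_divide) simp
  finally show ?thesis
    \<comment> \<open>The terms with n < l vanish; as \<open>l \<ge> 1\<close> this includes n = 0,
      so the entry \<open>c\<close> does not enter.\<close>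
    unfolding term_eq[symmetric] by (subst (asm) sums_zero_iff_shift) (auto simp: binomial_eq_0)
qed

text \<open>Extending the inner sum to l \<le> k adds only vanishing binomials and lets the column
  sums be taken first. Then C(k-1,l-1)/l = C(k,l)/k and the binomial theorem give a k-th power; the
  absent term l = 0 is the subtracted \<open>vseq b\<close>. Since \<open>k \<ge> 1\<close>, the
  zeroth entries \<open>c'\<close> and \<open>c''\<close> are arbitrary.\<close>

lemma moebius_row_sums:
  fixes a b d x :: complex
  assumes "norm (a * x) < 1" "k \<ge> 1"
  shows "(\<lambda>n. (\<Sum>l = 1..min k n. of_nat (n choose l) * of_nat ((k - 1) choose (l - 1)) *
            a ^ (n - l) * (- b) ^ (k - l) * d ^ l) * vseq x c n)
    sums (vseq (b + d * x / (1 + a * x)) c' k - vseq b c'' k)"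
proof -
  let ?q = "- x / (1 + a * x)"
  have "(\<lambda>n. (\<Sum>l = 1..min k n. of_nat (n choose l) * of_nat ((k - 1) choose (l - 1)) *
            a ^ (n - l) * (- b) ^ (k - l) * d ^ l) * vseq x c n)
      = (\<lambda>n. \<Sum>l = 1..k. of_nat ((k - 1) choose (l - 1)) * (- b) ^ (k - l) * d ^ l *
            (of_nat (n choose l) * a ^ (n - l) * vseq x c n))"
    unfolding sum_distrib_right
    by (intro ext sum.mono_neutral_cong_left) (auto simp: binomial_eq_0 mult_ac)
  also have "\<dots> sums (\<Sum>l = 1..k. of_nat ((k - 1) choose (l - 1)) * (- b) ^ (k - l) * d ^ l *
            (- (1 / of_nat l * ?q ^ l)))"
    by (intro sums_sum sums_mult binomial_column_sums assms) auto
  also have "(\<Sum>l = 1..k. of_nat ((k - 1) choose (l - 1)) * (- b) ^ (k - l) * d ^ l * (- (1 / of_nat l * ?q ^ l)))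
      = (\<Sum>l = 1..k. - (1 / of_nat k) * (of_nat (k choose l) * (d * ?q) ^ l * (- b) ^ (k - l)))"
  proof (intro sum.cong refl)
    fix l assume l: "l \<in> {1..k}"
    have "l * (k choose l) = k * ((k - 1) choose (l - 1))"
      using l by (intro times_binomial_minus1_eq) auto
    hence "of_nat l * of_nat (k choose l) = of_nat k * (of_nat ((k - 1) choose (l - 1)) :: complex)"
      by (simp only: of_nat_mult[symmetric])
    moreover have "of_nat l \<noteq> (0 :: complex)" "of_nat k \<noteq> (0 :: complex)"
      using l by auto
    ultimately have "of_nat ((k - 1) choose (l - 1)) / of_nat l = (of_nat (k choose l) / of_nat k :: complex)"
      by (simp add: field_simps)
    moreover have "of_nat ((k - 1) choose (l - 1)) * (- b) ^ (k - l) * d ^ l * (- (1 / of_nat l * ?q ^ l))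
        = - (of_nat ((k - 1) choose (l - 1)) / of_nat l) * ((d * ?q) ^ l * (- b) ^ (k - l))"
      unfolding power_mult_distrib by (simp only: mult_ac times_divide_eq_left times_divide_eq_right mult_minus_left mult_minus_right mult_1_left mult_1_right)
    ultimately show "of_nat ((k - 1) choose (l - 1)) * (- b) ^ (k - l) * d ^ l * (- (1 / of_nat l * ?q ^ l))
        = - (1 / of_nat k) * (of_nat (k choose l) * (d * ?q) ^ l * (- b) ^ (k - l))"
      by (simp only: mult_ac times_divide_eq_left times_divide_eq_right mult_minus_left mult_minus_right mult_1_left mult_1_right)
  qed
  also have "\<dots> = - (1 / of_nat k) * ((d * ?q + - b) ^ k - (- b) ^ k)"
  proof -
    have "(d * ?q + - b) ^ k = (\<Sum>l\<le>k. of_nat (k choose l) * (d * ?q) ^ l * (- b) ^ (k - l))"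
      by (rule binomial_ring)
    also have "\<dots> = (- b) ^ k + (\<Sum>l = 1..k. of_nat (k choose l) * (d * ?q) ^ l * (- b) ^ (k - l))"
      by (simp add: sum.atMost_shift atLeast1_atMost_eq_remove0 atMost_atLeast0 sum.remove[of _ 0])
    finally show ?thesis by (simp add: sum_distrib_left)
  qed
  also have "d * ?q + - b = - (b + d * x / (1 + a * x))"
    by simp
  also have "- (1 / of_nat k) * ((- (b + d * x / (1 + a * x))) ^ k - (- b) ^ k)
      = vseq (b + d * x / (1 + a * x)) c' k - vseq b c'' k"
    using assms(2) by (simp add: vseq_def algebra_simps diff_divide_distrib)
  finally show ?thesis .
qed

lemma ln_row_sums:
  fixes a x :: complex
  assumes "norm (a * x) < 1"
  shows "(\<lambda>n. (if n = 0 then 0 else a ^ n) * vseq x c n) sums ln (1 + a * x)"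
proof -
  have "(if n = 0 then 0 else a ^ n) * vseq x c n = (-1) ^ Suc n / of_nat n * (a * x) ^ n" for n
    using power_mult_distrib[of "-1" x n] by (auto simp: vseq_def power_mult_distrib)
  thus ?thesis using Ln_series[OF assms] by simp
qed

section \<open>The sequence space and the Moebius maps\<close>

lemma sum_fun_apply: "(\<Sum>i\<in>S. g i) k = (\<Sum>i\<in>S. g i k)"
  by (induction S rule: infinite_finite_induct) auto

lemma vseq_in_V_space: "cmod x \<le> 1 \<Longrightarrow> vseq x c \<in> V_space"
  unfolding V_space_def by (intro cseq.span_base) auto

lemma sum_scale_in_V_space:
  assumes "\<And>i. i \<in> S \<Longrightarrow> g i \<in> V_space"
  shows "(\<lambda>k. \<Sum>i\<in>S. a i * g i k) \<in> V_space"
proof -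
  have "(\<lambda>k. \<Sum>i\<in>S. a i * g i k) = (\<Sum>i\<in>S. seq_scale (a i) (g i))"
    by (simp add: fun_eq_iff sum_fun_apply seq_scale_def)
  also have "\<dots> \<in> V_space"
    using assms unfolding V_space_def by (intro cseq.span_sum cseq.span_scale)
  finally show ?thesis .
qed

lemma infmat_apply_sum:
  assumes "\<And>i k. i \<in> S \<Longrightarrow> summable (\<lambda>n. B k n * g i n)"
  shows "infmat_apply B (\<lambda>k. \<Sum>i\<in>S. a i * g i k) = (\<lambda>k. \<Sum>i\<in>S. a i * infmat_apply B (g i) k)"
proof
  fix k
  have "infmat_apply B (\<lambda>k. \<Sum>i\<in>S. a i * g i k) k = (\<Sum>n. \<Sum>i\<in>S. a i * (B k n * g i n))"
    by (simp add: infmat_apply_def sum_distrib_left mult_ac)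
  also have "\<dots> = (\<Sum>i\<in>S. \<Sum>n. a i * (B k n * g i n))"
    using assms by (intro suminf_sum summable_mult)
  also have "\<dots> = (\<Sum>i\<in>S. a i * infmat_apply B (g i) k)"
    unfolding infmat_apply_def using assms by (intro sum.cong refl suminf_mult)
  finally show "infmat_apply B (\<lambda>k. \<Sum>i\<in>S. a i * g i k) k = (\<Sum>i\<in>S. a i * infmat_apply B (g i) k)" .
qed

text \<open>Convergence of the row series and membership of the image pass from the generators to
  finite combinations by span induction; linearity then follows from summability.\<close>

lemma defines_linear_operator_on_V_spaceI:
  assumes "\<And>x c k. cmod x \<le> 1 \<Longrightarrow> summable (\<lambda>n. B k n * vseq x c n)"
    and "\<And>x c. cmod x \<le> 1 \<Longrightarrow> infmat_apply B (vseq x c) \<in> V_space"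
  shows "defines_linear_operator_on B V_space"
proof -
  have span: "(\<forall>k. summable (\<lambda>n. B k n * u n)) \<and> infmat_apply B u \<in> V_space" if "u \<in> V_space" for u
    using that unfolding V_space_def
  proof (induction rule: cseq.span_induct_alt)
    case base
    have "infmat_apply B 0 = 0" by (simp add: infmat_apply_def fun_eq_iff)
    thus ?case by (simp only: cseq.span_zero) simp
  next
    case (step c v u)
    obtain x y where v: "v = vseq x y" "cmod x \<le> 1" using step.hyps by auto
    have summ: "summable (\<lambda>n. B k n * v n)" "summable (\<lambda>n. B k n * u n)" for k
      using assms(1) v step.IH by auto
    have eq: "(\<lambda>n. B k n * (seq_scale c v + u) n) = (\<lambda>n. c * (B k n * v n) + B k n * u n)" for k
      by (simp add: seq_scale_def algebra_simps)
    have "infmat_apply B (seq_scale c v + u) k = (seq_scale c (infmat_apply B v) + infmat_apply B u) k" for k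
    proof -
      have "infmat_apply B (seq_scale c v + u) k = (\<Sum>n. c * (B k n * v n) + B k n * u n)"
        unfolding infmat_apply_def eq ..
      also have "\<dots> = (\<Sum>n. c * (B k n * v n)) + (\<Sum>n. B k n * u n)"
        by (intro suminf_add[symmetric] summable_mult summ)
      also have "(\<Sum>n. c * (B k n * v n)) = c * (\<Sum>n. B k n * v n)"
        by (intro suminf_mult summ)
      finally show ?thesis by (simp add: infmat_apply_def seq_scale_def)
    qed
    hence app: "infmat_apply B (seq_scale c v + u) = seq_scale c (infmat_apply B v) + infmat_apply B u" ..
    have "infmat_apply B v \<in> cseq.span {vseq x c |x c. cmod x \<le> 1}"
      using assms(2)[OF v(2)] unfolding v(1) V_space_def .
    thus ?case
      unfolding eq app using summ step.IH
      by (intro conjI allI summable_add summable_mult cseq.span_add cseq.span_scale) auto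
  qed
  show ?thesis
    unfolding defines_linear_operator_on_def
  proof (intro conjI ballI allI)
    fix u u' assume "u \<in> V_space" "u' \<in> V_space"
    hence "\<And>k. summable (\<lambda>n. B k n * u n)" "\<And>k. summable (\<lambda>n. B k n * u' n)"
      using span by auto
    thus "infmat_apply B (u + u') = infmat_apply B u + infmat_apply B u'"
      by (simp add: fun_eq_iff infmat_apply_def distrib_left suminf_add[symmetric])
  next
    fix a u assume "u \<in> V_space"
    hence "\<And>k. summable (\<lambda>n. B k n * u n)" using span by auto
    thus "infmat_apply B (seq_scale a u) = seq_scale a (infmat_apply B u)"
      by (simp add: fun_eq_iff infmat_apply_def seq_scale_def mult.left_commute[of _ a] suminf_mult)
  qed (use span in auto)
qed

section \<open>The disc picture of a positive matrix\<close>

lemma F_map_entries: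
  "F_map B $ 1 $ 1 = (B $ 1 $ 1 - B $ 1 $ 2 - B $ 2 $ 1 + B $ 2 $ 2) / 2"
  "F_map B $ 1 $ 2 = (B $ 1 $ 1 + B $ 1 $ 2 - B $ 2 $ 1 - B $ 2 $ 2) / 2"
  "F_map B $ 2 $ 1 = (B $ 1 $ 1 - B $ 1 $ 2 + B $ 2 $ 1 - B $ 2 $ 2) / 2"
  "F_map B $ 2 $ 2 = (B $ 1 $ 1 + B $ 1 $ 2 + B $ 2 $ 1 + B $ 2 $ 2) / 2"
  by (simp_all add: F_map_def Let_def)

text \<open>\<open>F_map\<close> is conjugation by the rotation through pi/4.\<close>

lemma det_F_map: "det (F_map B) = det B"
  by (simp add: det_2 F_map_entries field_simps)

lemma F_map_corner_bounds:
  assumes "positive_matrix B"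
  shows "0 < F_map B $ 2 $ 2" "\<bar>F_map B $ 2 $ 1\<bar> < F_map B $ 2 $ 2"
proof -
  have "B $ 1 $ 1 > 0" "B $ 1 $ 2 > 0" "B $ 2 $ 1 > 0" "B $ 2 $ 2 > 0"
    using assms by (auto simp: positive_matrix_def)
  thus "0 < F_map B $ 2 $ 2" and "\<bar>F_map B $ 2 $ 1\<bar> < F_map B $ 2 $ 2"
    unfolding F_map_entries by (auto simp: abs_less_iff)
qed

lemma moebius_zero: "moebius M 0 = of_real (M $ 1 $ 2 / M $ 2 $ 2)"
  by (simp add: moebius_def)

lemma moebius_transpose_zero: "moebius (transpose M) 0 = of_real (M $ 2 $ 1 / M $ 2 $ 2)"
  by (simp add: moebius_def transpose_def)

lemma deriv_moebius_zero:
  assumes "M $ 2 $ 2 \<noteq> 0"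
  shows "deriv (moebius M) 0 = of_real (det M / (M $ 2 $ 2)\<^sup>2)"
proof -
  have "((\<lambda>x. (of_real (M $ 1 $ 1) * x + of_real (M $ 1 $ 2)) /
                 (of_real (M $ 2 $ 1) * x + of_real (M $ 2 $ 2))) has_field_derivative
      of_real (det M / (M $ 2 $ 2)\<^sup>2)) (at (0 :: complex))"
    by (rule derivative_eq_intros refl | use assms in \<open>force simp: det_2 power2_eq_square\<close>)+
  thus ?thesis
    unfolding moebius_def[abs_def] by (rule DERIV_imp_deriv)
qed

lemma F_map_denominator_bound:
  assumes "positive_matrix B" "cmod x \<le> 1"
  shows "cmod (of_real (F_map B $ 2 $ 1 / F_map B $ 2 $ 2) * x) < 1"
proof -
  have "\<bar>F_map B $ 2 $ 1 / F_map B $ 2 $ 2\<bar> < 1"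
    using F_map_corner_bounds[OF assms(1)] by simp
  moreover have "\<bar>F_map B $ 2 $ 1 / F_map B $ 2 $ 2\<bar> * cmod x \<le> \<bar>F_map B $ 2 $ 1 / F_map B $ 2 $ 2\<bar> * 1"
    using assms(2) by (intro mult_left_mono) auto
  ultimately show ?thesis by (simp only: norm_mult norm_of_real)
qed

text \<open>Rests on d (a x + b) = b (c x + d) + (a d - b c) x. The right-hand side uses just the
  parameters f(0), f'(0) and the transposed value at 0 that occur in
  \<open>lyap_matrix\<close>.\<close>

lemma fractional_linear_expansion:
  fixes a b c d x :: "'a::field"
  assumes "d \<noteq> 0" "c * x + d \<noteq> 0"
  shows "(a * x + b) / (c * x + d) = b / d + (a * d - b * c) / d\<^sup>2 * x / (1 + c / d * x)"
proof -
  have "1 + c / d * x = (c * x + d) / d"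
    using assms by (simp add: add_divide_distrib)
  hence "(a * d - b * c) / d\<^sup>2 * x / (1 + c / d * x) = (a * d - b * c) * x / (d * (c * x + d))"
    using assms by (simp add: power2_eq_square)
  moreover have "b / d = b * (c * x + d) / (d * (c * x + d))"
    using assms by simp
  moreover have "(a * x + b) / (c * x + d) = d * (a * x + b) / (d * (c * x + d))"
    using assms by simp
  moreover have "d * (a * x + b) = b * (c * x + d) + (a * d - b * c) * x"
    by (simp add: algebra_simps)
  ultimately show ?thesis by (simp only: add_divide_distrib)
qed

lemma moebius_expansion:
  assumes "positive_matrix B" "cmod x \<le> 1"
  defines "M \<equiv> F_map B"
  shows "moebius M x = moebius M 0 + deriv (moebius M) 0 * x / (1 + moebius (transpose M) 0 * x)"
proof -
  have d: "M $ 2 $ 2 \<noteq> 0"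
    using F_map_corner_bounds[OF assms(1)] unfolding M_def by auto
  have "cmod (of_real (M $ 2 $ 1 / M $ 2 $ 2) * x) < 1"
    using F_map_denominator_bound[OF assms(1,2)] unfolding M_def .
  hence "1 + complex_of_real (M $ 2 $ 1 / M $ 2 $ 2) * x \<noteq> 0"
    by (metis add_eq_0_iff2 norm_minus_cancel norm_one less_irrefl)
  hence "of_real (M $ 2 $ 1) * x + complex_of_real (M $ 2 $ 2) \<noteq> 0"
    using d by (simp add: field_simps)
  thus ?thesis
    using fractional_linear_expansion[of "complex_of_real (M $ 2 $ 2)" "of_real (M $ 2 $ 1)" x
        "of_real (M $ 1 $ 1)" "of_real (M $ 1 $ 2)"] d
    unfolding deriv_moebius_zero[OF d] moebius_zero moebius_transpose_zero
    by (simp add: moebius_def det_2 transpose_def)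
qed

text \<open>The squared modulus of the denominator exceeds that of the numerator by a combination of
  |1+x|^2, |1-x|^2 and 1-|x|^2 with positive coefficients.\<close>

lemma cmod_moebius_le_1:
  assumes "positive_matrix B" "cmod x \<le> 1"
  shows "cmod (moebius (F_map B) x) \<le> 1"
proof -
  define p q r s where "p = B $ 1 $ 1" and "q = B $ 1 $ 2" and "r = B $ 2 $ 1" and "s = B $ 2 $ 2"
  have pos: "0 < p" "0 < q" "0 < r" "0 < s"
    using assms by (auto simp: positive_matrix_def p_def q_def r_def s_def)
  let ?num = "of_real (F_map B $ 1 $ 1) * x + of_real (F_map B $ 1 $ 2)"
  let ?den = "of_real (F_map B $ 2 $ 1) * x + of_real (F_map B $ 2 $ 2)"
  have "(cmod ?den)\<^sup>2 - (cmod ?num)\<^sup>2 = p * r * (cmod (1 + x))\<^sup>2 + q * s * (cmod (1 - x))\<^sup>2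
      + (p * s + q * r) * (1 - (cmod x)\<^sup>2)"
    unfolding cmod_power2 F_map_entries p_def q_def r_def s_def
    by (simp add: power2_eq_square field_simps)
  also have "\<dots> \<ge> 0"
    using pos assms(2) by (intro add_nonneg_nonneg mult_nonneg_nonneg) (auto simp: abs_square_le_1)
  finally have "(cmod ?num)\<^sup>2 \<le> (cmod ?den)\<^sup>2" by simp
  hence "cmod ?num \<le> cmod ?den"
    by (rule power2_le_imp_le) (rule norm_ge_zero)
  hence "cmod ?num / cmod ?den \<le> 1"
    using norm_ge_zero[of ?den] by (metis divide_le_eq_1 div_by_0 antisym_conv2 zero_le_one)
  thus ?thesis
    by (simp only: moebius_def norm_divide)
qed

section \<open>The operator on the spanning vectors\<close>

lemma disc_coord_one: "disc_coord 1 = 0"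
  by (simp add: disc_coord_def)

lemma disc_coord_bound: "pos_vec u \<Longrightarrow> \<bar>disc_coord u\<bar> < 1"
  by (auto simp: disc_coord_def pos_vec_def abs_less_iff divide_simps)

lemma half_sum_disc_coord:
  assumes "pos_vec u"
  shows "half_sum u * (c * disc_coord u + d) = c * ((u $ 1 - u $ 2) / 2) + d * half_sum u"
proof -
  have "half_sum u * disc_coord u = (u $ 1 - u $ 2) / 2"
  proof -
    have "u $ 1 + u $ 2 > 0" using assms by (auto simp: pos_vec_def)
    moreover have "s / 2 * (d / s) = d / 2" if "s > 0" for s d :: real
      using that by simp
    ultimately show ?thesis unfolding half_sum_def disc_coord_def by blast
  qed
  moreover have "half_sum u * (c * disc_coord u + d) = c * (half_sum u * disc_coord u) + d * half_sum u"
    by (simp add: algebra_simps)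
  ultimately show ?thesis by (simp only:)
qed

text \<open>Half the difference and half the sum of the entries of \<open>u\<close> are
  \<open>half_sum u\<close> times \<open>disc_coord u\<close> and 1; in these rotated coordinates
  \<open>B\<close> acts as \<open>F_map B\<close>.\<close>

lemma F_map_disc_coord:
  assumes "pos_vec u" "pos_vec (B *v u)"
  shows "half_sum (B *v u) = half_sum u * (F_map B $ 2 $ 1 * disc_coord u + F_map B $ 2 $ 2)"
    and "half_sum (B *v u) * disc_coord (B *v u) = half_sum u * (F_map B $ 1 $ 1 * disc_coord u + F_map B $ 1 $ 2)"
proof -
  show "half_sum (B *v u) = half_sum u * (F_map B $ 2 $ 1 * disc_coord u + F_map B $ 2 $ 2)"
    unfolding half_sum_disc_coord[OF assms(1)]
    by (simp add: half_sum_def matrix_vector_mult_2 F_map_entries field_simps)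
  show "half_sum (B *v u) * disc_coord (B *v u) = half_sum u * (F_map B $ 1 $ 1 * disc_coord u + F_map B $ 1 $ 2)"
    unfolding half_sum_disc_coord[OF assms(1)]
    using half_sum_disc_coord[OF assms(2), of 1 0]
    by (simp add: half_sum_def matrix_vector_mult_2 F_map_entries field_simps)
qed

lemma moebius_disc_coord:
  assumes "positive_matrix B" "pos_vec u"
  shows "moebius (F_map B) (of_real (disc_coord u)) = of_real (disc_coord (B *v u))"
proof -
  note p = assms(2) pos_vec_matrix_mult[OF assms]
  have "disc_coord (B *v u) = (half_sum (B *v u) * disc_coord (B *v u)) / half_sum (B *v u)"
    using half_sum_pos[OF p(2)] by simp
  also have "\<dots> = (F_map B $ 1 $ 1 * disc_coord u + F_map B $ 1 $ 2) / (F_map B $ 2 $ 1 * disc_coord u + F_map B $ 2 $ 2)"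
    unfolding F_map_disc_coord(2)[OF p] unfolding F_map_disc_coord(1)[OF p]
    using half_sum_pos[OF p(1)] by simp
  finally show ?thesis by (simp add: moebius_def)
qed

text \<open>The argument equals \<open>half_sum (B *v u) / (half_sum u * half_sum (B *v 1))\<close>,
  which is real and positive, so the principal branch is the real logarithm.\<close>

lemma ln_denominator_disc_coord:
  assumes "positive_matrix B" "pos_vec u"
  shows "ln (1 + moebius (transpose (F_map B)) 0 * of_real (disc_coord u))
    = complex_of_real (ln (half_sum (B *v u)) - ln (half_sum u) - ln (half_sum (B *v 1)))"
proof -
  let ?c = "F_map B $ 2 $ 1" and ?d = "F_map B $ 2 $ 2"
  note pos = half_sum_pos[OF assms(2)] half_sum_pos[OF pos_vec_matrix_mult[OF assms]]
  have d: "?d > 0" using F_map_corner_bounds[OF assms(1)] by simp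
  have d_eq: "half_sum (B *v 1) = ?d"
    by (simp add: half_sum_mult_one F_map_entries)
  have "half_sum (B *v u) = (half_sum u * ?d) * (1 + ?c / ?d * disc_coord u)"
    unfolding F_map_disc_coord(1)[OF assms(2) pos_vec_matrix_mult[OF assms]]
    using d by (simp add: field_simps)
  hence eq: "1 + ?c / ?d * disc_coord u = half_sum (B *v u) / (half_sum u * ?d)"
    using d pos by simp
  have "ln (1 + moebius (transpose (F_map B)) 0 * of_real (disc_coord u))
      = ln (complex_of_real (half_sum (B *v u) / (half_sum u * ?d)))"
    unfolding moebius_transpose_zero eq[symmetric] by simp
  also have "\<dots> = complex_of_real (ln (half_sum (B *v u) / (half_sum u * ?d)))"
    using pos d by (intro Ln_of_real) simp
  also have "ln (half_sum (B *v u) / (half_sum u * ?d)) = ln (half_sum (B *v u)) - ln (half_sum u) - ln ?d"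
    using pos d by (simp add: ln_div ln_mult)
  finally show ?thesis by (simp add: d_eq)
qed

context positive_matrix_family begin

abbreviation mob :: "'i \<Rightarrow> complex \<Rightarrow> complex" where
  "mob i \<equiv> moebius (F_map (A i))"

abbreviation mobT :: "'i \<Rightarrow> complex \<Rightarrow> complex" where
  "mobT i \<equiv> moebius (transpose (F_map (A i)))"

abbreviation T_op :: "(nat \<Rightarrow> complex) \<Rightarrow> nat \<Rightarrow> complex" where
  "T_op \<equiv> infmat_apply (lyap_matrix I w A)"

text \<open>Row 0 is the Taylor series of the logarithm, and the other rows come from
  \<open>moebius_row_sums\<close>. The zeroth entries are chosen so that one formula covers all
  rows.\<close>

lemma lyap_matrix_vseq_sums:
  assumes x: "cmod x \<le> 1"
  shows "(\<lambda>n. lyap_matrix I w A k n * vseq x c n) sums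
    (\<Sum>i\<in>I. of_real (w i) * (vseq (mob i x) (ln (1 + mobT i 0 * x)) k - vseq (mob i 0) 0 k))"
proof -
  have lt: "norm (mobT i 0 * x) < 1" if "i \<in> I" for i
    using F_map_denominator_bound[OF positive_A[OF that] x] by (simp only: moebius_transpose_zero)
  show ?thesis
  proof (cases "k = 0")
    case True
    have "lyap_matrix I w A k n * vseq x c n
        = (\<Sum>i\<in>I. of_real (w i) * ((if n = 0 then 0 else mobT i 0 ^ n) * vseq x c n))" for n
      using True by (simp add: lyap_matrix_def sum_distrib_right mult.assoc)
    moreover have "(\<lambda>n. \<Sum>i\<in>I. of_real (w i) * ((if n = 0 then 0 else mobT i 0 ^ n) * vseq x c n))
        sums (\<Sum>i\<in>I. of_real (w i) * ln (1 + mobT i 0 * x))"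
      by (intro sums_sum sums_mult ln_row_sums lt)
    ultimately show ?thesis using True by (simp add: vseq_def)
  next
    case False
    have "lyap_matrix I w A k n * vseq x c n
        = (\<Sum>i\<in>I. of_real (w i) * ((\<Sum>l = 1..min k n. of_nat (n choose l) * of_nat ((k - 1) choose (l - 1)) *
            mobT i 0 ^ (n - l) * (- mob i 0) ^ (k - l) * deriv (mob i) 0 ^ l) * vseq x c n))" for n
      using False by (simp add: lyap_matrix_def Let_def sum_distrib_right mult.assoc)
    moreover have "(\<lambda>n. \<Sum>i\<in>I. of_real (w i) * ((\<Sum>l = 1..min k n. of_nat (n choose l) * of_nat ((k - 1) choose (l - 1)) *
            mobT i 0 ^ (n - l) * (- mob i 0) ^ (k - l) * deriv (mob i) 0 ^ l) * vseq x c n))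
        sums (\<Sum>i\<in>I. of_real (w i) * (vseq (mob i 0 + deriv (mob i) 0 * x / (1 + mobT i 0 * x)) (ln (1 + mobT i 0 * x)) k
            - vseq (mob i 0) 0 k))"
      using False by (intro sums_sum sums_mult moebius_row_sums lt) auto
    moreover have "mob i x = mob i 0 + deriv (mob i) 0 * x / (1 + mobT i 0 * x)" if "i \<in> I" for i
      by (rule moebius_expansion[OF positive_A[OF that] x])
    ultimately show ?thesis by simp
  qed
qed

lemma T_op_vseq:
  assumes "cmod x \<le> 1"
  shows "T_op (vseq x c) = (\<lambda>k. \<Sum>i\<in>I. of_real (w i) *
    (vseq (mob i x) (ln (1 + mobT i 0 * x)) k - vseq (mob i 0) 0 k))"
  using sums_unique[OF lyap_matrix_vseq_sums[OF assms]] by (simp add: infmat_apply_def fun_eq_iff)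

lemma cmod_mob_le_1: "i \<in> I \<Longrightarrow> cmod x \<le> 1 \<Longrightarrow> cmod (mob i x) \<le> 1"
  by (intro cmod_moebius_le_1 positive_A)

lemma lyap_matrix_linear: "defines_linear_operator_on (lyap_matrix I w A) V_space"
proof (rule defines_linear_operator_on_V_spaceI)
  fix x c assume x: "cmod x \<le> 1"
  show "summable (\<lambda>n. lyap_matrix I w A k n * vseq x c n)" for k
    using lyap_matrix_vseq_sums[OF x] by (rule sums_summable)
  have "vseq (mob i x) (ln (1 + mobT i 0 * x)) - vseq (mob i 0) 0 \<in> V_space" if "i \<in> I" for i
    using vseq_in_V_space[OF cmod_mob_le_1[OF that x]] vseq_in_V_space[OF cmod_mob_le_1[OF that, of 0]]
    unfolding V_space_def by (intro cseq.span_diff) auto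
  from sum_scale_in_V_space[of I, OF this, where a = "\<lambda>i. of_real (w i)"]
  show "T_op (vseq x c) \<in> V_space"
    by (simp add: T_op_vseq[OF x])
qed

lemma T_op_add: "u \<in> V_space \<Longrightarrow> u' \<in> V_space \<Longrightarrow> T_op (u + u') = T_op u + T_op u'"
  and T_op_scale: "u \<in> V_space \<Longrightarrow> T_op (seq_scale a u) = seq_scale a (T_op u)"
  and T_op_summable: "u \<in> V_space \<Longrightarrow> summable (\<lambda>n. lyap_matrix I w A k n * u n)"
  using lyap_matrix_linear unfolding defines_linear_operator_on_def by blast+

text \<open>\<open>vseq 0 c\<close> is supported at index 0, where the matrix has a zero
  column.\<close>

lemma T_op_delta: "T_op (vseq 0 c) = 0"
proof -
  have "lyap_matrix I w A k n * vseq 0 c n = 0" for k n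
    by (cases "n = 0") (auto simp: lyap_matrix_def vseq_def)
  thus ?thesis by (simp only: infmat_apply_def fun_eq_iff suminf_zero zero_fun_apply simp_thms)
qed

section \<open>Telescoping of the series\<close>

text \<open>For positive \<open>u\<close>, the Taylor coefficients at 0 of the logarithm of the
  linear form y \<mapsto> (u1 (1 + y) + u2 (1 - y)) / 2.\<close>

definition state_vseq :: "real^2 \<Rightarrow> nat \<Rightarrow> complex" where
  "state_vseq u = vseq (of_real (disc_coord u)) (of_real (ln (half_sum u)))"

lemma state_vseq_in_V_space: "u \<in> slope_cone \<Longrightarrow> state_vseq u \<in> V_space"
  unfolding state_vseq_def using disc_coord_bound[OF cone_pos, of u] by (intro vseq_in_V_space) simp

lemma T_op_state_vseq:
  assumes u: "u \<in> slope_cone"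
  shows "T_op (state_vseq u) k = avg (\<lambda>u. state_vseq u k) u - avg (\<lambda>u. state_vseq u k) 1
    - of_real (if k = 0 then ln (half_sum u) else 0)"
proof -
  let ?x = "complex_of_real (disc_coord u)" and ?c = "of_real (if k = 0 then ln (half_sum u) else 0) :: complex"
  have x: "cmod ?x \<le> 1" using disc_coord_bound[OF cone_pos[OF u]] by simp
  \<comment> \<open>For k > 0 this only moves the disc points \<open>?x\<close> and 0, the latter
    belonging to the vector \<open>1\<close>. For k = 0 the logarithm of the denominator splits into
    three terms, one of which is the correction \<open>?c\<close>.\<close>
  have summand: "vseq (mob i ?x) (ln (1 + mobT i 0 * ?x)) k - vseq (mob i 0) 0 k
      = state_vseq (A i *v u) k - state_vseq (A i *v 1) k - ?c" if i: "i \<in> I" for i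
    using moebius_disc_coord[OF positive_A[OF i] cone_pos[OF u]] moebius_disc_coord[OF positive_A[OF i] pos_vec_one]
      ln_denominator_disc_coord[OF positive_A[OF i] cone_pos[OF u]]
    by (simp add: state_vseq_def disc_coord_one vseq_def)
  have "T_op (state_vseq u) k = (\<Sum>i\<in>I. of_real (w i) * (state_vseq (A i *v u) k - state_vseq (A i *v 1) k - ?c))"
    unfolding state_vseq_def[of u] T_op_vseq[OF x] by (intro sum.cong refl) (simp only: summand)
  also have "\<dots> = avg (\<lambda>u. state_vseq u k) u - avg (\<lambda>u. state_vseq u k) 1 - avg (\<lambda>_. ?c) u"
    unfolding avg_def scaleR_conv_of_real by (simp only: right_diff_distrib sum_subtractf)
  finally show ?thesis by (simp only: avg_const)
qed

lemma avg_in_V_space: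
  assumes "\<And>u. u \<in> slope_cone \<Longrightarrow> \<Phi> u \<in> V_space" "u \<in> slope_cone"
  shows "(\<lambda>k. avg (\<lambda>u. \<Phi> u k) u) \<in> V_space"
    and "T_op (\<lambda>k. avg (\<lambda>u. \<Phi> u k) u) = (\<lambda>k. avg (\<lambda>u. T_op (\<Phi> u) k) u)"
proof -
  have V: "\<Phi> (A i *v u) \<in> V_space" if "i \<in> I" for i
    using assms cone_invariant[OF that] by blast
  show "(\<lambda>k. avg (\<lambda>u. \<Phi> u k) u) \<in> V_space"
    unfolding avg_def scaleR_conv_of_real by (rule sum_scale_in_V_space[OF V])
  show "T_op (\<lambda>k. avg (\<lambda>u. \<Phi> u k) u) = (\<lambda>k. avg (\<lambda>u. T_op (\<Phi> u) k) u)"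
    unfolding avg_def scaleR_conv_of_real by (rule infmat_apply_sum[OF T_op_summable[OF V]])
qed

text \<open>Every iterate is a finite combination of values on the cone, so the row series may be
  exchanged with the averages.\<close>

lemma funpow_avg_in_V_space:
  assumes "\<And>u. u \<in> slope_cone \<Longrightarrow> \<Phi> u \<in> V_space" "u \<in> slope_cone"
  shows "(\<lambda>k. (avg ^^ n) (\<lambda>u. \<Phi> u k) u) \<in> V_space"
    and "T_op (\<lambda>k. (avg ^^ n) (\<lambda>u. \<Phi> u k) u) = (\<lambda>k. (avg ^^ n) (\<lambda>u. T_op (\<Phi> u) k) u)"
proof -
  have "(\<lambda>k. (avg ^^ n) (\<lambda>u. \<Phi> u k) u) \<in> V_space \<and>
      T_op (\<lambda>k. (avg ^^ n) (\<lambda>u. \<Phi> u k) u) = (\<lambda>k. (avg ^^ n) (\<lambda>u. T_op (\<Phi> u) k) u)" if "u \<in> slope_cone" for u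
    using that
  proof (induction n arbitrary: u)
    case 0
    thus ?case using assms(1) by simp
  next
    case (Suc n)
    have V: "(\<lambda>k. (avg ^^ n) (\<lambda>u. \<Phi> u k) v) \<in> V_space" if "v \<in> slope_cone" for v
      using Suc.IH[OF that] by blast
    have "avg (\<lambda>v. T_op (\<lambda>k. (avg ^^ n) (\<lambda>u. \<Phi> u k) v) k) u = avg (\<lambda>v. (avg ^^ n) (\<lambda>u. T_op (\<Phi> u) k) v) u" for k
      unfolding avg_def[of _ u] using Suc.IH cone_invariant[OF _ Suc.prems] by (intro sum.cong refl) simp
    thus ?case
      using avg_in_V_space[of "\<lambda>v k. (avg ^^ n) (\<lambda>u. \<Phi> u k) v", OF V Suc.prems] by simp
  qed
  with assms(2) show "(\<lambda>k. (avg ^^ n) (\<lambda>u. \<Phi> u k) u) \<in> V_space"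
    and "T_op (\<lambda>k. (avg ^^ n) (\<lambda>u. \<Phi> u k) u) = (\<lambda>k. (avg ^^ n) (\<lambda>u. T_op (\<Phi> u) k) u)"
    by blast+
qed

lemma funpow_avg_of_real: "(avg ^^ n) (\<lambda>u. complex_of_real (\<Phi> u)) u = of_real ((avg ^^ n) \<Phi> u)"
  by (induction n arbitrary: u) (simp_all add: avg_def scaleR_conv_of_real)

lemma funpow_avg_cong:
  assumes "\<And>u. u \<in> slope_cone \<Longrightarrow> \<Phi> u = \<Psi> u" "u \<in> slope_cone"
  shows "(avg ^^ n) \<Phi> u = (avg ^^ n) \<Psi> u"
  using assms(2)
proof (induction n arbitrary: u)
  case (Suc n)
  have "avg ((avg ^^ n) \<Phi>) u = avg ((avg ^^ n) \<Psi>) u"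
    unfolding avg_def[of _ u] by (intro sum.cong refl arg_cong2[where f = scaleR] Suc.IH cone_invariant Suc.prems)
  thus ?case by simp
qed (use assms in auto)

definition mean_log :: "nat \<Rightarrow> real" where
  "mean_log n = (avg ^^ n) (\<lambda>u. ln (half_sum u)) 1"

definition mean_vseq :: "nat \<Rightarrow> nat \<Rightarrow> complex" where
  "mean_vseq n k = (avg ^^ n) (\<lambda>u. state_vseq u k) 1"

lemma mean_vseq_in_V_space: "mean_vseq n \<in> V_space"
  using funpow_avg_in_V_space(1)[OF state_vseq_in_V_space one_in_cone]
  by (simp add: mean_vseq_def[abs_def])

lemma mean_vseq_0: "mean_vseq n 0 = of_real (mean_log n)"
  by (simp add: mean_vseq_def mean_log_def state_vseq_def vseq_def funpow_avg_of_real)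

text \<open>The walk starts at \<open>1\<close>, which has half sum 1 and disc coordinate 0.\<close>

lemma mean_vseq_zero: "mean_vseq 0 = 0"
  by (auto simp: fun_eq_iff mean_vseq_def state_vseq_def disc_coord_def half_sum_def vseq_def)

lemma T_op_mean_vseq:
  "T_op (mean_vseq n) k = mean_vseq (Suc n) k - mean_vseq 1 k - of_real (if k = 0 then mean_log n else 0)"
proof -
  have "T_op (mean_vseq n) k = (avg ^^ n) (\<lambda>u. T_op (state_vseq u) k) 1"
    using funpow_avg_in_V_space(2)[OF state_vseq_in_V_space one_in_cone] by (simp add: mean_vseq_def[abs_def])
  also have "\<dots> = (avg ^^ n) (\<lambda>u. avg (\<lambda>u. state_vseq u k) u - mean_vseq 1 k
      - of_real (if k = 0 then ln (half_sum u) else 0)) 1"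
    by (rule funpow_avg_cong[OF _ one_in_cone]) (simp add: T_op_state_vseq mean_vseq_def)
  also have "\<dots> = mean_vseq (Suc n) k - mean_vseq 1 k - of_real (if k = 0 then mean_log n else 0)"
    unfolding funpow_avg_diff funpow_avg_const funpow_avg_of_real
    by (simp add: mean_vseq_def mean_log_def funpow_swap1 funpow_avg_const)
  finally show ?thesis .
qed

lemma mean_log_increment_tendsto: "(\<lambda>n. mean_log (Suc n) - mean_log n) \<longlonglongrightarrow> rate"
  using funpow_log_growth_converges(1)[OF one_in_cone] unfolding funpow_log_growth mean_log_def .

text \<open>In the induction the two copies of \<open>mean_vseq 1\<close> cancel,
  \<open>T_op\<close> kills the previous correction at index 0, and a new one appears. For n = 0
  truncated subtraction makes the correction vanish.\<close>

lemma funpow_T_op: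
  "(T_op ^^ n) (mean_vseq 1) = mean_vseq (Suc n) - mean_vseq n - vseq 0 (of_real (mean_log n - mean_log (n - 1)))"
proof (induction n)
  case 0
  thus ?case by (simp add: mean_vseq_zero fun_eq_iff vseq_def)
next
  case (Suc n)
  let ?d = "vseq 0 (of_real (mean_log n - mean_log (n - 1)))"
  have V: "mean_vseq (Suc n) \<in> V_space" "mean_vseq n \<in> V_space" "?d \<in> V_space"
    by (auto intro: mean_vseq_in_V_space vseq_in_V_space)
  have neg: "seq_scale (-1) v \<in> V_space" if "v \<in> V_space" for v
    using that unfolding V_space_def by (rule cseq.span_scale)
  have add: "seq_scale (-1) (mean_vseq n) + seq_scale (-1) ?d \<in> V_space"
    using neg[OF V(2)] neg[OF V(3)] unfolding V_space_def by (rule cseq.span_add)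
  have "mean_vseq (Suc n) - mean_vseq n - ?d = mean_vseq (Suc n) + (seq_scale (-1) (mean_vseq n) + seq_scale (-1) ?d)"
    by (simp add: seq_scale_def fun_eq_iff)
  hence "(T_op ^^ Suc n) (mean_vseq 1) = T_op (mean_vseq (Suc n) + (seq_scale (-1) (mean_vseq n) + seq_scale (-1) ?d))"
    using Suc by (simp only: funpow.simps o_apply)
  also have "\<dots> = T_op (mean_vseq (Suc n)) + (seq_scale (-1) (T_op (mean_vseq n)) + seq_scale (-1) (T_op ?d))"
    using V neg add by (simp only: T_op_add T_op_scale)
  also have "\<dots> = mean_vseq (Suc (Suc n)) - mean_vseq (Suc n) - vseq 0 (of_real (mean_log (Suc n) - mean_log (Suc n - 1)))"
    unfolding T_op_delta by (auto simp: fun_eq_iff T_op_mean_vseq seq_scale_def vseq_def)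
  finally show ?case .
qed

lemma T_op_series_sums: "(\<lambda>n. (T_op ^^ n) (mean_vseq 1) 0) sums of_real rate"
proof -
  \<comment> \<open>The terms of the series are second differences of \<open>mean_log\<close>, so
    they telescope to \<open>g\<close>; truncation gives \<open>g 0 = 0\<close>.\<close>
  define g where "g n = mean_log n - mean_log (n - 1)" for n
  have "(T_op ^^ n) (mean_vseq 1) 0 = of_real (g (Suc n)) - of_real (g n)" for n
    unfolding funpow_T_op by (simp add: mean_vseq_0 g_def vseq_def)
  moreover have "(\<lambda>n. complex_of_real (g (Suc n)) - of_real (g n)) sums (of_real rate - of_real (g 0))"
  proof (rule telescope_sums)
    have "(\<lambda>n. g (Suc n)) \<longlonglongrightarrow> rate"
      using mean_log_increment_tendsto by (simp add: g_def)
    hence "g \<longlonglongrightarrow> rate" by (rule LIMSEQ_imp_Suc)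
    thus "(\<lambda>n. complex_of_real (g n)) \<longlonglongrightarrow> of_real rate"
      by (intro tendsto_of_real)
  qed
  ultimately show ?thesis by (simp add: g_def)
qed

text \<open>With d the lower right entry of \<open>F_map (A i)\<close>, f'(0) is the determinant
  over d^2. Invertibility permits cancelling the determinant, half the logarithm is ln d, and d is
  the half sum of \<open>A i *v 1\<close>.\<close>

lemma lyap_vector_eq:
  assumes inv: "\<And>i. i \<in> I \<Longrightarrow> invertible (A i)"
  shows "lyap_vector I w A = mean_vseq 1"
proof
  fix k
  have "vseq (mob i 0) (1 / 2 * ln (of_real (det (F_map (A i))) / deriv (mob i) 0)) = state_vseq (A i *v 1)"
    if i: "i \<in> I" for i
  proof -
    let ?d = "F_map (A i) $ 2 $ 2"
    have d: "?d > 0" using F_map_corner_bounds[OF positive_A[OF i]] by simp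
    hence d_ne: "?d \<noteq> 0" by simp
    have "det (F_map (A i)) \<noteq> 0"
      using inv[OF i] by (simp add: det_F_map invertible_det_nz)
    hence "complex_of_real (det (F_map (A i))) / deriv (mob i) 0 = of_real (?d ^ 2)"
      using d unfolding deriv_moebius_zero[OF d_ne] by (simp flip: of_real_divide)
    moreover have "ln (complex_of_real (?d ^ 2)) = 2 * of_real (ln ?d)"
      using d by (subst Ln_of_real) (simp_all add: ln_realpow)
    moreover have "half_sum (A i *v 1) = ?d"
      by (simp add: half_sum_mult_one F_map_entries)
    ultimately show ?thesis
      using moebius_disc_coord[OF positive_A[OF i] pos_vec_one]
      by (simp add: state_vseq_def disc_coord_one)
  qed
  thus "lyap_vector I w A k = mean_vseq 1 k"
    by (simp add: lyap_vector_def Let_def sum_fun_apply seq_scale_def mean_vseq_def avg_def scaleR_conv_of_real)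
qed

end

theorem theorem1p1:
  fixes I :: "'i set" and A :: "'i \<Rightarrow> real^2^2" and w :: "'i \<Rightarrow> real"
  assumes "finite I"
    and "\<And>i. i \<in> I \<Longrightarrow> invertible (A i)"
    and "\<And>i. i \<in> I \<Longrightarrow> positive_matrix (A i)"
    and "\<And>i. i \<in> I \<Longrightarrow> w i > 0"
    and "(\<Sum>i\<in>I. w i) = 1"
  shows "lyap_vector I w A \<in> V_space \<and>
    defines_linear_operator_on (lyap_matrix I w A) V_space \<and>
    (\<lambda>n. (infmat_apply (lyap_matrix I w A) ^^ n) (lyap_vector I w A) 0)
      sums complex_of_real (top_lyapunov_exponent I w A)"
proof -
  interpret positive_matrix_family I A w
    using assms by unfold_locales auto
  have "lyap_vector I w A = mean_vseq 1"
    using assms(2) by (rule lyap_vector_eq)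
  thus ?thesis
    unfolding top_lyapunov_exponent_eq_rate
    using mean_vseq_in_V_space lyap_matrix_linear T_op_series_sums by simp
qed

end
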